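(* Let $T_t(\omega,x)=T(\omega,t,x):=x\,e^{B_t^\epsilon(\omega)}$ for $x\in D_0\equiv\mathbb{S}^1$, $t\in[0,\tau]$, where $B_t^\epsilon$ is the regularized Brownian motion. Then there are random variables $C_1,C_2,C_3$ such that for a.e. $\omega$ (i) $\max_{t\in[0,\tau],\,x\in D_0}\|T(\omega,t,x)\|\le C_1(\omega)$ and $\max_{t\in[0,\tau],\,x\in D_0}\|DT(\omega,t,x)\|\le C_2(\omega)$; (ii) $\max_{t\in[0,\tau],\,x\in\mathbb{S}^1}\big\|\tfrac{d}{dt}T(\omega,t,x)\big\|\le C_3(\omega)$. Moreover, $C_i\in L^p(\Omega)$ for $i=1,2,3$ and every $p\in[1,\infty)$, while for $i=1,2$ the bounds $C_i$ are not in $L^\infty(\Omega)$ (that is, no random variable $C_i\in L^\infty(\Omega)$ satisfies the corresponding inequality in (i)).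
   Context: $(\Omega,\mathcal{F},\mathbb{P})$ is a complete probability space, $\tau\in(0,\infty)$, and $(B_t)_{t\ge0}$ is a standard real-valued Brownian motion. For fixed $\epsilon>0$, $B_t^\epsilon:=\int_0^t\rho_\epsilon(t-u)B_u\,du$, where $\rho_\epsilon(s)=\epsilon^{-1}\rho(s/\epsilon)$ is the standard mollifier, $\rho(s)=c\exp(-1/(1-s^2))$ for $|s|<1$ and $\rho(s)=0$ otherwise, with $c$ chosen so that $\int\rho=1$; thus $t\mapsto B_t^\epsilon$ is $C^1$ on $[0,\tau]$. $\mathbb{S}^1\subset\mathbb{R}^2$ is the unit circle, $\|\cdot\|$ is the Euclidean norm on vectors and the operator norm on matrices, and $DT(\omega,t,x)=e^{B_t^\epsilon(\omega)}\,\mathrm{Id}$ is the spatial Jacobian matrix. *)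

theory Defs
  imports "HOL-Probability.Probability"
begin

text \<open>
  Standard Brownian motion indexed by the reals in \<open>[0, \<infinity>)\<close>; values of \<open>B\<close> at negative times are
  irrelevant. The initial condition and path continuity are required almost surely.
\<close>

definition standard_brownian_motion :: "'a measure \<Rightarrow> (real \<Rightarrow> 'a \<Rightarrow> real) \<Rightarrow> bool" where
  "standard_brownian_motion M B \<longleftrightarrow>
     prob_space M \<and>
     (\<forall>t\<ge>0. B t \<in> borel_measurable M) \<and>
     (AE \<omega> in M. B 0 \<omega> = 0) \<and>
     (\<forall>s\<ge>0. \<forall>t>s. distributed M lborel (\<lambda>\<omega>. B t \<omega> - B s \<omega>) (normal_density 0 (sqrt (t - s)))) \<and>
     (\<forall>(n::nat) (t::nat \<Rightarrow> real). 0 \<le> t 0 \<and> (\<forall>i<n. t i \<le> t (Suc i)) \<longrightarrow>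
        prob_space.indep_vars M (\<lambda>_. borel) (\<lambda>i \<omega>. B (t (Suc i)) \<omega> - B (t i) \<omega>) {..<n}) \<and>
     (AE \<omega> in M. continuous_on {0..} (\<lambda>t. B t \<omega>))"

definition bump :: "real \<Rightarrow> real" where
  "bump s = (if \<bar>s\<bar> < 1 then exp (- 1 / (1 - s\<^sup>2)) else 0)"

definition mollifier :: "real \<Rightarrow> real" where
  "mollifier s = (1 / (LINT r|lborel. bump r)) * bump s"

lemma integrable_bump: "integrable lborel bump"
  and integral_bump_pos: "0 < (LINT s|lborel. bump s)"
proof -
  have m [measurable]: "bump \<in> borel_measurable borel"
    unfolding bump_def by measurable
  have le: "norm (bump s) \<le> norm (indicator {-1..1} s :: real)" for s
  proof (cases "\<bar>s\<bar> < 1")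
    case True
    then have "s\<^sup>2 < 1" by (simp add: abs_square_less_1)
    then show ?thesis using True by (auto simp add: bump_def indicator_def)
  qed (simp add: bump_def)
  show int: "integrable lborel bump"
  proof (rule Bochner_Integration.integrable_bound)
    show "integrable lborel (indicator {-1..1::real} :: real \<Rightarrow> real)"
      by simp
  qed (use le in auto)
  have nn: "0 \<le> bump s" for s by (simp add: bump_def)
  have "integral\<^sup>L lborel bump \<noteq> 0"
  proof
    assume "integral\<^sup>L lborel bump = 0"
    then have "AE s in lborel. bump s = 0"
      using integral_nonneg_eq_0_iff_AE[OF int] nn by auto
    then have "AE s in lborel. s \<notin> {-1<..<1::real}"
      by eventually_elim (auto simp: bump_def abs_less_iff split: if_splits)
    then have "emeasure lborel {-1<..<1::real} = 0"
      by (subst (asm) AE_iff_measurable[where N="{-1<..<1}"]) auto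
    then show False by simp
  qed
  moreover have "0 \<le> integral\<^sup>L lborel bump" using nn by simp
  ultimately show "0 < (LINT s|lborel. bump s)" by simp
qed

lemma integral_mollifier: "(LINT s|lborel. mollifier s) = 1"
  using integral_bump_pos by (simp add: mollifier_def)

definition scaled_mollifier :: "real \<Rightarrow> real \<Rightarrow> real" where
  "scaled_mollifier \<epsilon> s = (1 / \<epsilon>) * mollifier (s / \<epsilon>)"

definition regularize :: "real \<Rightarrow> (real \<Rightarrow> 'a \<Rightarrow> real) \<Rightarrow> real \<Rightarrow> 'a \<Rightarrow> real" where
  "regularize \<epsilon> B t \<omega> = (LBINT u:{0..t}. scaled_mollifier \<epsilon> (t - u) * B u \<omega>)"

definition flow :: "real \<Rightarrow> (real \<Rightarrow> 'a \<Rightarrow> real) \<Rightarrow> 'a \<Rightarrow> real \<Rightarrow> real^2 \<Rightarrow> real^2" where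
  "flow \<epsilon> B \<omega> t x = exp (regularize \<epsilon> B t \<omega>) *\<^sub>R x"

definition flow_jacobian :: "real \<Rightarrow> (real \<Rightarrow> 'a \<Rightarrow> real) \<Rightarrow> 'a \<Rightarrow> real \<Rightarrow> real^2 \<Rightarrow> real^2^2" where
  "flow_jacobian \<epsilon> B \<omega> t x = jacobian (flow \<epsilon> B \<omega> t) (at x)"

lemma flow_jacobian_eq: "flow_jacobian \<epsilon> B \<omega> t x = exp (regularize \<epsilon> B t \<omega>) *\<^sub>R mat 1"
proof -
  let ?c = "exp (regularize \<epsilon> B t \<omega>)"
  have "(flow \<epsilon> B \<omega> t has_derivative (\<lambda>h. ?c *\<^sub>R h)) (at x)"
    unfolding flow_def by (auto intro!: derivative_eq_intros)
  then have "frechet_derivative (flow \<epsilon> B \<omega> t) (at x) = (\<lambda>h. ?c *\<^sub>R h)"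
    by (rule frechet_derivative_at[symmetric])
  then show ?thesis
    by (simp add: flow_jacobian_def jacobian_def matrix_def mat_def vec_eq_iff axis_def)
qed

text \<open>
  The derivative is taken within \<open>[0, \<tau>]\<close>, so it is one-sided at the endpoints.
\<close>

definition flow_dt :: "real \<Rightarrow> real \<Rightarrow> (real \<Rightarrow> 'a \<Rightarrow> real) \<Rightarrow> 'a \<Rightarrow> real \<Rightarrow> real^2 \<Rightarrow> real^2" where
  "flow_dt \<tau> \<epsilon> B \<omega> t x = vector_derivative (\<lambda>s. flow \<epsilon> B \<omega> s x) (at t within {0..\<tau>})"

text \<open>The matrix norm is the operator norm; the library's \<open>norm\<close> on matrices is the Frobenius norm.\<close>

definition matrix_opnorm :: "real^2^2 \<Rightarrow> real" where
  "matrix_opnorm A = onorm (\<lambda>v. A *v v)"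

text \<open>The maximum of \<open>f\<close> over \<open>A\<close> exists and is at most \<open>c\<close>.\<close>

definition max_le :: "('b \<Rightarrow> real) \<Rightarrow> 'b set \<Rightarrow> real \<Rightarrow> bool" where
  "max_le f A c \<longleftrightarrow> (\<exists>a\<in>A. (\<forall>b\<in>A. f b \<le> f a) \<and> f a \<le> c)"

definition in_Lp :: "'a measure \<Rightarrow> real \<Rightarrow> ('a \<Rightarrow> real) \<Rightarrow> bool" where
  "in_Lp M p X \<longleftrightarrow> X \<in> borel_measurable M \<and> integrable M (\<lambda>\<omega>. \<bar>X \<omega>\<bar> powr p)"

definition in_Linf :: "'a measure \<Rightarrow> ('a \<Rightarrow> real) \<Rightarrow> bool" where
  "in_Linf M X \<longleftrightarrow> X \<in> borel_measurable M \<and> esssup M (\<lambda>\<omega>. ereal \<bar>X \<omega>\<bar>) < \<infinity>"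

end

theory Submission
  imports Defs "HOL-Real_Asymp.Real_Asymp"
begin

text \<open>
  Let \<open>S\<close> be the sum over all dyadic levels of the largest increment of \<open>B\<close> at that level. By chaining
  \<open>S\<close> dominates \<open>sup |B|\<close> on \<open>[0, \<tau>]\<close>, and all exponential moments of \<open>S\<close> are finite by the Gaussian
  ones of the increments. Both \<open>B\<^sup>\<epsilon>\<close> and its time derivative
  \<open>\<rho>\<^sub>\<epsilon>(0) B\<^sub>t + \<integral>\<^sub>0\<^sup>t \<rho>\<^sub>\<epsilon>'(t - u) B\<^sub>u du\<close> are bounded by constant multiples of \<open>S\<close>, so exponentials
  of multiples of \<open>S\<close> serve as \<open>C\<^sub>1, C\<^sub>2, C\<^sub>3\<close>. An essentially bounded \<open>C\<^sub>1\<close> or \<open>C\<^sub>2\<close> would bound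
  \<open>B\<^sup>\<epsilon>\<^sub>t\<close> from above for a small \<open>t > 0\<close>; this variable is a limit of centred Gaussian Riemann sums
  whose variances stay away from zero, so it has no upper bound.
\<close>

section \<open>Smoothness of the regularization\<close>

text \<open>Away from 0 this is calculus on an open half-line. At 0 the factor
  \<open>exp (- 1 / x)\<close> beats every power of \<open>1 / x\<close>, so the difference quotient
  \<open>g x / x\<close> and \<open>g'\<close> itself both tend to 0 from the right; on the left
  everything is 0.\<close>

lemma exp_neg_inverse_C1:
  fixes g g' :: "real \<Rightarrow> real"
  assumes g_def: "g = (\<lambda>x. if 0 < x then exp (- 1 / x) else 0)"
    and g'_def: "g' = (\<lambda>x. if 0 < x then exp (- 1 / x) / x\<^sup>2 else 0)"
  shows "(g has_real_derivative g' x) (at x)" "isCont g' x"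
proof -
  consider "0 < x" | "x < 0" | "x = 0" by linarith
  then have "(g has_real_derivative g' x) (at x) \<and> isCont g' x"
  proof cases
    case 1
    have "((\<lambda>x. exp (- 1 / x)) has_real_derivative g' x) (at x)"
      using 1 by (auto intro!: derivative_eq_intros simp: g'_def power2_eq_square)
    then have "(g has_real_derivative g' x) (at x)"
      by (rule has_field_derivative_transform_within_open[where S="{0<..}"]) (use 1 in \<open>auto simp: g_def\<close>)
    moreover have "eventually (\<lambda>y. y \<in> {0<..}) (nhds x)"
      using 1 by (intro eventually_nhds_in_open) auto
    then have "eventually (\<lambda>y. g' y = exp (- 1 / y) / y\<^sup>2) (nhds x)"
      by eventually_elim (simp add: g'_def)
    then have "isCont g' x \<longleftrightarrow> isCont (\<lambda>x. exp (- 1 / x) / x\<^sup>2) x"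
      by (rule isCont_cong)
    moreover have "isCont (\<lambda>x. exp (- 1 / x) / x\<^sup>2) x"
      using 1 by (intro continuous_intros) auto
    ultimately show ?thesis by simp
  next
    case 2
    have "((\<lambda>x. 0) has_real_derivative g' x) (at x)"
      using 2 by (auto simp: g'_def)
    then have "(g has_real_derivative g' x) (at x)"
      by (rule has_field_derivative_transform_within_open[where S="{..<0}"]) (use 2 in \<open>auto simp: g_def\<close>)
    moreover have "eventually (\<lambda>y. y \<in> {..<0}) (nhds x)"
      using 2 by (intro eventually_nhds_in_open) auto
    then have "eventually (\<lambda>y. g' y = 0) (nhds x)"
      by eventually_elim (simp add: g'_def)
    then have "isCont g' x"
      using isCont_cong by fastforce
    ultimately show ?thesis ..
  next
    case 3
    have r: "((\<lambda>x::real. exp (- 1 / x) / x) \<longlongrightarrow> 0) (at_right 0)"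
      "((\<lambda>x::real. exp (- 1 / x) / x\<^sup>2) \<longlongrightarrow> 0) (at_right 0)"
      by real_asymp+
    have "((\<lambda>x. g x / x) \<longlongrightarrow> 0) (at_right 0)"
      by (rule Lim_transform_eventually[OF r(1)]) (auto simp: eventually_at_filter g_def)
    moreover have "((\<lambda>x. g x / x) \<longlongrightarrow> 0) (at_left 0)"
      by (rule Lim_transform_eventually[OF tendsto_const]) (auto simp: eventually_at_filter g_def)
    ultimately have "((\<lambda>x. g x / x) \<longlongrightarrow> 0) (at 0)"
      by (simp add: filterlim_split_at)
    then have "((\<lambda>h. (g (0 + h) - g 0) / h) \<longlongrightarrow> 0) (at 0)"
      by (simp add: g_def)
    then have "(g has_real_derivative g' x) (at x)"
      using 3 by (simp add: DERIV_def g'_def)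
    moreover have "(g' \<longlongrightarrow> 0) (at_right 0)"
      by (rule Lim_transform_eventually[OF r(2)]) (auto simp: eventually_at_filter g'_def)
    moreover have "(g' \<longlongrightarrow> 0) (at_left 0)"
      by (rule Lim_transform_eventually[OF tendsto_const]) (auto simp: eventually_at_filter g'_def)
    ultimately show ?thesis
      using 3 by (simp add: filterlim_split_at isCont_def g'_def)
  qed
  then show "(g has_real_derivative g' x) (at x)" "isCont g' x" by auto
qed

text \<open>As \<open>\<bar>s\<bar> < 1\<close> means \<open>0 < 1 - s\<^sup>2\<close>, the bump is
  the flat function \<open>g\<close> composed with \<open>1 - s\<^sup>2\<close>; regularity at the
  edge of the support comes from the flatness of \<open>g\<close> at 0.\<close>

lemma scaled_mollifier_C1:
  obtains k' where "\<And>s. (scaled_mollifier \<epsilon> has_real_derivative k' s) (at s)"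
    and "continuous_on UNIV k'"
proof -
  define g where "g = (\<lambda>x::real. if 0 < x then exp (- 1 / x) else 0)"
  define g' where "g' = (\<lambda>x::real. if 0 < x then exp (- 1 / x) / x\<^sup>2 else 0)"
  note g = exp_neg_inverse_C1[OF g_def g'_def]
  have bump: "bump s = g (1 - s\<^sup>2)" for s
    by (simp add: bump_def g_def abs_square_less_1)
  have b: "scaled_mollifier \<epsilon> = (\<lambda>s. 1 / \<epsilon> * (1 / integral\<^sup>L lborel bump * g (1 - (s / \<epsilon>)\<^sup>2)))"
    by (simp add: fun_eq_iff scaled_mollifier_def mollifier_def flip: bump)
  have [continuous_intros]: "continuous_on A f \<Longrightarrow> continuous_on A (\<lambda>x. g' (f x))"
    for A and f :: "real \<Rightarrow> real"
    by (rule continuous_on_compose2[of UNIV g']) (use g(2) in \<open>auto simp: continuous_at_imp_continuous_on\<close>)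
  have "((\<lambda>s. 1 - (s / \<epsilon>)\<^sup>2) has_real_derivative - (2 * (s / \<epsilon>) * (1 / \<epsilon>))) (at s)" for s
    by (auto intro!: derivative_eq_intros simp: divide_inverse)
  note d = DERIV_cmult[OF DERIV_cmult[OF DERIV_chain2[OF g(1) this]]]
  show ?thesis
    by (rule that, unfold b, rule d) (auto simp: divide_inverse intro!: continuous_intros)
qed

lemma scaled_mollifier_pos: "\<bar>s\<bar> < \<epsilon> \<Longrightarrow> 0 < scaled_mollifier \<epsilon> s"
  using integral_bump_pos by (auto simp: scaled_mollifier_def mollifier_def bump_def abs_divide)

text \<open>Truncating the kernel argument at zero turns the moving upper limit into a fixed one.\<close>

lemma continuous_on_Volterra:
  fixes \<phi> b :: "real \<Rightarrow> real"
  assumes \<phi>: "continuous_on {0..\<tau>} \<phi>" and b: "continuous_on {0..\<tau>} b"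
  shows "continuous_on {0..\<tau>} (\<lambda>t. integral {0..t} (\<lambda>u. \<phi> (t - u) * b u))"
proof -
  have "continuous_on ({0..\<tau>} \<times> cbox 0 \<tau>) (\<lambda>(t, u). \<phi> (max (t - u) 0) * b u)"
    unfolding split_beta
    by (auto intro!: continuous_intros continuous_on_compose2[OF \<phi>] continuous_on_compose2[OF b])
  then have 1: "continuous_on {0..\<tau>} (\<lambda>t. integral {0..\<tau>} (\<lambda>u. \<phi> (max (t - u) 0) * b u))"
    using integral_continuous_on_param[of "{0..\<tau>}" 0 \<tau> "\<lambda>t u. \<phi> (max (t - u) 0) * b u"] by simp
  have 2: "continuous_on {0..\<tau>} (\<lambda>t. integral {0..t} b)"
    using b by (intro indefinite_integral_continuous_1 integrable_continuous_interval)
  \<comment> \<open>To the right of \<open>u = t\<close> the truncated kernel is frozen at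
    \<open>\<phi> 0\<close>, so the fixed-limit integral exceeds the wanted one by
    \<open>\<phi> 0\<close> times the integral of \<open>b\<close> over
    \<open>{t..\<tau>}\<close>.\<close>
  have eq: "integral {0..t} (\<lambda>u. \<phi> (t - u) * b u) =
      integral {0..\<tau>} (\<lambda>u. \<phi> (max (t - u) 0) * b u) - \<phi> 0 * (integral {0..\<tau>} b - integral {0..t} b)"
    if t: "t \<in> {0..\<tau>}" for t
  proof -
    have c: "continuous_on {0..\<tau>} (\<lambda>u. \<phi> (max (t - u) 0) * b u)"
      using t by (auto intro!: continuous_intros continuous_on_compose2[OF \<phi>] b)
    have "integral {0..\<tau>} (\<lambda>u. \<phi> (max (t - u) 0) * b u) =
        integral {0..t} (\<lambda>u. \<phi> (max (t - u) 0) * b u) + integral {t..\<tau>} (\<lambda>u. \<phi> (max (t - u) 0) * b u)"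
      using t c by (intro Henstock_Kurzweil_Integration.integral_combine[symmetric] integrable_continuous_interval) auto
    also have "integral {0..t} (\<lambda>u. \<phi> (max (t - u) 0) * b u) = integral {0..t} (\<lambda>u. \<phi> (t - u) * b u)"
      by (rule integral_cong) (auto simp: max_def)
    also have "integral {t..\<tau>} (\<lambda>u. \<phi> (max (t - u) 0) * b u) = integral {t..\<tau>} (\<lambda>u. \<phi> 0 * b u)"
      by (rule integral_cong) (auto simp: max_def)
    also have "\<dots> = \<phi> 0 * (integral {0..\<tau>} b - integral {0..t} b)"
      using t b Henstock_Kurzweil_Integration.integral_combine[of 0 t \<tau> b]
      by (simp add: integrable_continuous_interval)
    finally show ?thesis by simp
  qed
  show ?thesis
    by (rule continuous_on_eq[OF _ eq[symmetric]]) (intro continuous_intros 1 2)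
qed

text \<open>The time enters twice, in the kernel and as the upper limit. Separating the roles as
  \<open>F x y\<close> gives two partial derivatives, by the Leibniz rule in \<open>x\<close> and
  the fundamental theorem in \<open>y\<close>; the chain rule along the diagonal adds them
  up.\<close>

lemma has_real_derivative_Volterra:
  fixes k k' b :: "real \<Rightarrow> real"
  assumes k: "\<And>s. (k has_real_derivative k' s) (at s)" and k': "continuous_on UNIV k'"
    and b: "continuous_on {0..\<tau>} b" and t: "t \<in> {0..\<tau>}"
  shows "((\<lambda>t. integral {0..t} (\<lambda>u. k (t - u) * b u)) has_real_derivative
      k 0 * b t + integral {0..t} (\<lambda>u. k' (t - u) * b u)) (at t within {0..\<tau>})"
proof -
  have kc: "continuous_on UNIV k"
    by (auto intro!: continuous_at_imp_continuous_on DERIV_isCont[OF k])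
  define F where "F = (\<lambda>x y. integral {0..y} (\<lambda>u. k (x - u) * b u))"
  have fx: "((\<lambda>x. F x t) has_real_derivative integral {0..t} (\<lambda>u. k' (t - u) * b u)) (at t within {0..\<tau>})"
    unfolding F_def
  proof (rule leibniz_rule_field_derivative[where U="{0..\<tau>}" and a=0 and b=t and ?x0.0=t
        and f="\<lambda>x u. k (x - u) * b u" and fx="\<lambda>x u. k' (x - u) * b u", unfolded cbox_interval])
    show "((\<lambda>x. k (x - u) * b u) has_real_derivative k' (x - u) * b u) (at x within {0..\<tau>})" for x u
    proof -
      have "((\<lambda>x. x - u) has_real_derivative 1) (at x within {0..\<tau>})"
        by (auto intro!: derivative_eq_intros)
      from DERIV_cmult_right[OF DERIV_chain2[OF k this]] show ?thesis by simp
    qed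
    show "(\<lambda>u. k (x - u) * b u) integrable_on {0..t}" for x
      using t by (intro integrable_continuous_interval)
        (auto intro!: continuous_intros continuous_on_compose2[OF kc] continuous_on_subset[OF b])
    show "continuous_on ({0..\<tau>} \<times> {0..t}) (\<lambda>(x, u). k' (x - u) * b u)"
      unfolding split_beta using t
      by (auto intro!: continuous_intros continuous_on_compose2[OF k'] continuous_on_compose2[OF b])
  qed (use t in auto)
  have fy: "(F x has_derivative blinfun_mult_right (k (x - y) * b y)) (at y within {0..\<tau>})"
    if "y \<in> {0..\<tau>}" for x y
  proof -
    have "continuous_on {0..\<tau>} (\<lambda>u. k (x - u) * b u)"
      by (auto intro!: continuous_intros continuous_on_compose2[OF kc] b)
    from integral_has_vector_derivative[OF this that] show ?thesis
      unfolding F_def has_real_derivative_iff_has_vector_derivative[symmetric] has_field_derivative_def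
      by simp
  qed
  \<comment> \<open>What turns the two partials into a total derivative is continuity of the
    \<open>y\<close>-partial at the diagonal point, phrased for bounded linear maps.\<close>
  have cont: "continuous (at (t, t) within {0..\<tau>} \<times> {0..\<tau>}) (\<lambda>(x, y). blinfun_mult_right (k (x - y) * b y))"
  proof -
    have "continuous_on ({0..\<tau>} \<times> {0..\<tau>}) (\<lambda>(x, y). blinfun_mult_right (k (x - y) * b y))"
      unfolding split_beta using t
      by (auto intro!: continuous_intros continuous_on_compose2[OF kc] continuous_on_compose2[OF b])
    then show ?thesis using t by (auto simp: continuous_on_eq_continuous_within)
  qed
  have D: "((\<lambda>(x, y). F x y) has_derivative
      (\<lambda>(tx, ty). integral {0..t} (\<lambda>u. k' (t - u) * b u) * tx + blinfun_mult_right (k (t - t) * b t) ty))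
      (at (t, t) within {0..\<tau>} \<times> {0..\<tau>})"
    using fx fy cont t
    by (intro has_derivative_partialsI) (auto simp: has_field_derivative_def)
  have "((\<lambda>s. (s, s)) has_derivative (\<lambda>h. (h, h))) (at t within {0..\<tau>})"
    by (auto intro!: derivative_eq_intros)
  from has_derivative_in_compose[OF this has_derivative_subset[OF D]]
  have "((\<lambda>s. F s s) has_derivative
      (\<lambda>h. integral {0..t} (\<lambda>u. k' (t - u) * b u) * h + k 0 * b t * h)) (at t within {0..\<tau>})"
    by (simp add: image_subset_iff)
  then show ?thesis
    unfolding F_def has_field_derivative_def
    by (rule has_derivative_eq_rhs) (simp add: fun_eq_iff algebra_simps)
qed

section \<open>Exponential moments of the Brownian supremum\<close>

text \<open>Completing the square: tilting the centred density by \<open>exp (l * x)\<close> gives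
  \<open>exp (l\<^sup>2 * \<sigma>\<^sup>2 / 2)\<close> times the density with mean
  \<open>l * \<sigma>\<^sup>2\<close>. The factor 2 comes from
  \<open>exp (l * \<bar>x\<bar>) \<le> exp (l * x) + exp (- l * x)\<close>.\<close>

lemma (in prob_space) exp_abs_normal:
  fixes l :: real
  assumes X: "distributed M lborel X (normal_density 0 \<sigma>)" and \<sigma>: "0 < \<sigma>"
  shows "integrable M (\<lambda>\<omega>. exp (l * \<bar>X \<omega>\<bar>))"
    and "expectation (\<lambda>\<omega>. exp (l * \<bar>X \<omega>\<bar>)) \<le> 2 * exp (l\<^sup>2 * \<sigma>\<^sup>2 / 2)"
proof -
  have [measurable]: "X \<in> borel_measurable M"
    using distributed_measurable[OF X] by simp
  have nd: "normal_density 0 \<sigma> x * exp (l * x) = exp (l\<^sup>2 * \<sigma>\<^sup>2 / 2) * normal_density (l * \<sigma>\<^sup>2) \<sigma> x" for l x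
  proof -
    have "- (x\<^sup>2 / (2 * \<sigma>\<^sup>2)) + l * x = l\<^sup>2 * \<sigma>\<^sup>2 / 2 + - ((x - l * \<sigma>\<^sup>2)\<^sup>2 / (2 * \<sigma>\<^sup>2))"
      using \<sigma> by (simp add: field_simps power2_eq_square)
    then show ?thesis
      by (simp add: normal_density_def flip: exp_add)
  qed
  have le: "normal_density 0 \<sigma> x * exp (l * \<bar>x\<bar>) \<le>
      exp (l\<^sup>2 * \<sigma>\<^sup>2 / 2) * (normal_density (l * \<sigma>\<^sup>2) \<sigma> x + normal_density (- l * \<sigma>\<^sup>2) \<sigma> x)" for x
  proof -
    have "exp (l * \<bar>x\<bar>) \<le> exp (l * x) + exp (- l * x)"
      by (cases "0 \<le> x") auto
    then have "normal_density 0 \<sigma> x * exp (l * \<bar>x\<bar>) \<le> normal_density 0 \<sigma> x * (exp (l * x) + exp (- l * x))"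
      by (intro mult_left_mono) auto
    then show ?thesis
      using nd[of x l] nd[of x "-l"] by (simp add: algebra_simps)
  qed
  have "(\<integral>\<^sup>+\<omega>. ennreal (exp (l * \<bar>X \<omega>\<bar>)) \<partial>M) =
      (\<integral>\<^sup>+x. ennreal (normal_density 0 \<sigma> x) * ennreal (exp (l * \<bar>x\<bar>)) \<partial>lborel)"
    using distributed_nn_integral[OF X, of "\<lambda>x. ennreal (exp (l * \<bar>x\<bar>))"] by simp
  also have "\<dots> = (\<integral>\<^sup>+x. ennreal (normal_density 0 \<sigma> x * exp (l * \<bar>x\<bar>)) \<partial>lborel)"
    by (simp add: ennreal_mult')
  also have "\<dots> \<le> (\<integral>\<^sup>+x. ennreal (exp (l\<^sup>2 * \<sigma>\<^sup>2 / 2) *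
      (normal_density (l * \<sigma>\<^sup>2) \<sigma> x + normal_density (- l * \<sigma>\<^sup>2) \<sigma> x)) \<partial>lborel)"
    by (intro nn_integral_mono ennreal_leI le)
  also have "\<dots> = ennreal (LINT x|lborel. exp (l\<^sup>2 * \<sigma>\<^sup>2 / 2) *
      (normal_density (l * \<sigma>\<^sup>2) \<sigma> x + normal_density (- l * \<sigma>\<^sup>2) \<sigma> x))"
    using \<sigma> by (intro nn_integral_eq_integral AE_I2) (auto simp: normal_density_nonneg)
  also have "(LINT x|lborel. exp (l\<^sup>2 * \<sigma>\<^sup>2 / 2) *
      (normal_density (l * \<sigma>\<^sup>2) \<sigma> x + normal_density (- l * \<sigma>\<^sup>2) \<sigma> x)) = 2 * exp (l\<^sup>2 * \<sigma>\<^sup>2 / 2)"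
    using \<sigma> by (simp add: integrable_normal_density)
  finally have bound: "(\<integral>\<^sup>+\<omega>. ennreal (exp (l * \<bar>X \<omega>\<bar>)) \<partial>M) \<le> ennreal (2 * exp (l\<^sup>2 * \<sigma>\<^sup>2 / 2))" .
  show int: "integrable M (\<lambda>\<omega>. exp (l * \<bar>X \<omega>\<bar>))"
    using bound by (intro integrableI_bounded) (auto simp: top_unique less_top[symmetric])
  show "expectation (\<lambda>\<omega>. exp (l * \<bar>X \<omega>\<bar>)) \<le> 2 * exp (l\<^sup>2 * \<sigma>\<^sup>2 / 2)"
    using bound nn_integral_eq_integral[OF int] by simp
qed

section \<open>Chaining and convexity estimates for a single path\<close>

definition dyadic_osc :: "real \<Rightarrow> (real \<Rightarrow> real) \<Rightarrow> nat \<Rightarrow> real" where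
  "dyadic_osc \<tau> b n = (MAX k\<in>{..<2^n}. \<bar>b (real (Suc k) * \<tau> / 2^n) - b (real k * \<tau> / 2^n)\<bar>)"

lemma dyadic_osc_ge:
  "k < 2^n \<Longrightarrow> \<bar>b (real (Suc k) * \<tau> / 2^n) - b (real k * \<tau> / 2^n)\<bar> \<le> dyadic_osc \<tau> b n"
  unfolding dyadic_osc_def by (intro Max_ge) auto

lemma dyadic_osc_nonneg: "0 \<le> dyadic_osc \<tau> b n"
  using dyadic_osc_ge[of 0 n b \<tau>] by simp

lemma dyadic_osc_attained:
  obtains k where "k < 2^n" "dyadic_osc \<tau> b n = \<bar>b (real (Suc k) * \<tau> / 2^n) - b (real k * \<tau> / 2^n)\<bar>"
proof -
  have "dyadic_osc \<tau> b n \<in> (\<lambda>k. \<bar>b (real (Suc k) * \<tau> / 2^n) - b (real k * \<tau> / 2^n)\<bar>) ` {..<2^n}"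
    unfolding dyadic_osc_def by (intro Max_in) (auto simp: lessThan_empty_iff)
  then show ?thesis using that by auto
qed

text \<open>Chaining by induction on the level: an even index is already a grid point of the
  previous level, and an odd one is a single step of the new level to the right of its even
  predecessor. The chain starts from \<open>b 0 = 0\<close>.\<close>

lemma abs_dyadic_le:
  assumes "b 0 = 0" and "k \<le> 2^n"
  shows "\<bar>b (real k * \<tau> / 2^n)\<bar> \<le> (\<Sum>i\<le>n. dyadic_osc \<tau> b i)"
  using assms(2)
proof (induction n arbitrary: k)
  case 0
  then consider "k = 0" | "k = 1" by fastforce
  then show ?case
    using dyadic_osc_ge[of 0 0 b \<tau>] dyadic_osc_nonneg[of \<tau> b 0] assms(1) by cases auto
next
  case (Suc n)
  have even: "\<bar>b (real (2 * j) * \<tau> / 2^Suc n)\<bar> \<le> (\<Sum>i\<le>n. dyadic_osc \<tau> b i)" if "j \<le> 2^n" for j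
    using Suc.IH[OF that] by (simp add: field_simps)
  show ?case
  proof (cases "even k")
    case True
    then obtain j where "k = 2 * j" by blast
    then show ?thesis
      using even[of j] Suc.prems dyadic_osc_nonneg[of \<tau> b "Suc n"] by simp
  next
    case False
    then obtain j where k: "k = Suc (2 * j)" by (auto elim: oddE)
    then have "2 * j < 2^Suc n" using Suc.prems by simp
    then show ?thesis
      using even[of j] dyadic_osc_ge[of "2 * j" "Suc n" b \<tau>] unfolding k by simp
  qed
qed

text \<open>Dyadic points below \<open>t\<close> converge to it, the bound at each of them is a
  partial sum of a nonnegative series, and continuity carries the estimate over to
  \<open>t\<close>.\<close>

lemma abs_le_suminf_dyadic_osc:
  assumes b: "continuous_on {0..\<tau>} b" "b 0 = 0" and s: "summable (dyadic_osc \<tau> b)"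
    and t: "t \<in> {0..\<tau>}" and \<tau>: "0 < \<tau>"
  shows "\<bar>b t\<bar> \<le> (\<Sum>n. dyadic_osc \<tau> b n)"
proof -
  \<comment> \<open>\<open>k n\<close> rounds \<open>t\<close> down to the grid of level
    \<open>n\<close>, with error at most \<open>\<tau> / 2^n\<close>.\<close>
  define k where "k = (\<lambda>n::nat. nat \<lfloor>t * 2^n / \<tau>\<rfloor>)"
  define x where "x = (\<lambda>n. real (k n) * \<tau> / 2^n)"
  have k: "real (k n) = of_int \<lfloor>t * 2^n / \<tau>\<rfloor>" for n
    using t \<tau> by (simp add: k_def)
  have x: "t - \<tau> / 2^n \<le> x n \<and> x n \<le> t" for n
  proof -
    have "t * 2^n / \<tau> - 1 \<le> real (k n)" "real (k n) \<le> t * 2^n / \<tau>"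
      unfolding k by linarith+
    then have "(t * 2^n / \<tau> - 1) * (\<tau> / 2^n) \<le> real (k n) * (\<tau> / 2^n)"
      "real (k n) * (\<tau> / 2^n) \<le> t * 2^n / \<tau> * (\<tau> / 2^n)"
      using \<tau> by (intro mult_right_mono; simp)+
    then show ?thesis using \<tau> by (simp add: x_def left_diff_distrib diff_divide_distrib)
  qed
  have k_le: "k n \<le> 2^n" for n
  proof -
    have "t * 2^n / \<tau> \<le> 2^n" using t \<tau> by (simp add: field_simps)
    then have "real (k n) \<le> 2^n" using k[of n] of_int_floor_le[of "t * 2^n / \<tau>"] by linarith
    then show ?thesis using of_nat_le_iff[of "k n" "2^n", where 'a=real] by simp
  qed
  have "(\<lambda>n. t - \<tau> / 2^n) \<longlonglongrightarrow> t - \<tau> * 0"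
    unfolding divide_inverse power_inverse[symmetric]
    by (intro tendsto_intros LIMSEQ_power_zero) simp
  then have "x \<longlonglongrightarrow> t"
    using x by (intro tendsto_sandwich[of "\<lambda>n. t - \<tau> / 2^n" x sequentially "\<lambda>_. t"]) auto
  moreover have "x n \<in> {0..\<tau>}" for n
    using x[of n] t \<tau> by (auto simp: x_def)
  ultimately have "(\<lambda>n. \<bar>b (x n)\<bar>) \<longlonglongrightarrow> \<bar>b t\<bar>"
    using b(1) t by (intro tendsto_rabs) (auto simp: continuous_on_sequentially comp_def)
  moreover have "\<bar>b (x n)\<bar> \<le> (\<Sum>n. dyadic_osc \<tau> b n)" for n
    using abs_dyadic_le[of b, OF b(2) k_le[of n], of \<tau>] sum_le_suminf[OF s, of "{..n}"] dyadic_osc_nonneg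
    unfolding x_def by fastforce
  ultimately show ?thesis
    by (intro LIMSEQ_le_const2) auto
qed

text \<open>Jensen's inequality for the probability measure that puts the missing weight
  \<open>1 - sum q I\<close> on the value 0, where \<open>exp\<close> is 1. That atom leaves the
  mean \<open>Y\<close> unchanged, and the tangent to \<open>exp\<close> at \<open>Y\<close> gives
  the inequality.\<close>

lemma exp_weighted_sum_le:
  fixes q y :: "'i \<Rightarrow> real"
  assumes q: "\<And>i. i \<in> I \<Longrightarrow> 0 \<le> q i" "sum q I \<le> 1"
  shows "exp (\<Sum>i\<in>I. q i * y i) \<le> 1 + (\<Sum>i\<in>I. q i * exp (y i))"
proof -
  define Y where "Y = (\<Sum>i\<in>I. q i * y i)"
  have tangent: "exp Y * (1 + z - Y) \<le> exp z" for z
    using mult_left_mono[OF exp_ge_add_one_self[of "z - Y"], of "exp Y"]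
    by (simp add: algebra_simps flip: exp_add)
  have "exp Y * (sum q I * (1 - Y) + Y) = (\<Sum>i\<in>I. q i * (exp Y * (1 + y i - Y)))"
    by (simp add: Y_def[symmetric] algebra_simps sum.distrib sum_subtractf
        flip: sum_distrib_left sum_distrib_right)
  also have "\<dots> \<le> (\<Sum>i\<in>I. q i * exp (y i))"
    by (intro sum_mono mult_left_mono tangent q)
  finally have 1: "exp Y * (sum q I * (1 - Y) + Y) \<le> (\<Sum>i\<in>I. q i * exp (y i))" .
  \<comment> \<open>The atom at 0: the same tangent bound, taken with the leftover weight.\<close>
  have "(1 - sum q I) * (exp Y * (1 - Y)) \<le> (1 - sum q I) * 1"
    using tangent[of 0] q by (intro mult_left_mono) auto
  moreover have "0 \<le> sum q I" using q by (intro sum_nonneg)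
  ultimately show ?thesis
    using 1 unfolding Y_def[symmetric] by (simp add: algebra_simps)
qed

text \<open>
  With \<open>c = r\<^sup>i\<close> and \<open>r\<^sup>4 = 1/2\<close>, the factor \<open>c\<^sup>4\<close> pays for a maximum over \<open>2\<^sup>i\<close> increments.
\<close>

lemma exp_scaled_le:
  fixes c x :: real
  assumes "0 \<le> c" "c \<le> 1" "0 \<le> x"
  shows "exp (c * x) \<le> exp 1 + 24 * c^4 * exp (2 * x)"
proof (cases "c * x \<le> 1")
  case True
  then have "exp (c * x) \<le> exp 1" by simp
  moreover have "0 \<le> 24 * c^4 * exp (2 * x)" by simp
  ultimately show ?thesis by linarith
next
  case False
  \<comment> \<open>A single term of the exponential series; 24 is \<open>fact 4\<close>. It absorbs
    the \<open>x^4\<close> of the factor \<open>(c * x)^4 \<ge> 1\<close> that is inserted below to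
    create \<open>c^4\<close>.\<close>
  have "x^4 / fact 4 \<le> exp x"
  proof -
    have "(\<Sum>n\<in>{4}. x^n /\<^sub>R fact n) \<le> (\<Sum>n. x^n /\<^sub>R fact n)"
      using assms summable_exp_generic[of x] by (intro sum_le_suminf) auto
    then show ?thesis by (simp add: exp_def divide_inverse mult.commute)
  qed
  then have x4: "x^4 \<le> 24 * exp x" by (simp add: fact_numeral)
  have "c * x \<le> x" using assms by (simp add: mult_left_le_one_le)
  then have "exp (c * x) \<le> 1 * exp x" by simp
  also have "\<dots> \<le> (c * x)^4 * exp x"
    using False by (intro mult_right_mono one_le_power) auto
  also have "\<dots> \<le> c^4 * (24 * exp x) * exp x"
    unfolding power_mult_distrib using x4 assms by (intro mult_right_mono mult_left_mono) auto
  also have "\<dots> = 24 * c^4 * exp (2 * x)"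
    by (simp add: exp_add[symmetric] mult_2[symmetric])
  finally show ?thesis by (smt (verit) exp_gt_zero)
qed

section \<open>Moments of the chaining sum of Brownian motion\<close>

context
  fixes M :: "'a measure" and B :: "real \<Rightarrow> 'a \<Rightarrow> real" and \<tau> :: real
  assumes BM: "standard_brownian_motion M B" and \<tau>: "0 < \<tau>"
begin

interpretation prob_space M
  using BM by (simp add: standard_brownian_motion_def)

lemma brownian_measurable: "0 \<le> t \<Longrightarrow> B t \<in> borel_measurable M"
  using BM by (simp add: standard_brownian_motion_def)

lemma dyadic_osc_measurable: "(\<lambda>\<omega>. dyadic_osc \<tau> (\<lambda>t. B t \<omega>) n) \<in> borel_measurable M"
proof -
  have [measurable]: "B (real k * \<tau> / 2^n) \<in> borel_measurable M" for k
    using \<tau> by (intro brownian_measurable) simp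
  show ?thesis
    unfolding dyadic_osc_def by (intro borel_measurable_Max) measurable
qed

text \<open>The point is uniformity in \<open>n\<close>. Geometric weights turn the sum into a
  weighted mean, so convexity reduces the claim to one level at a time. At level \<open>i\<close>
  the maximum is replaced by the sum over all \<open>2^i\<close> increments, and the prefactor
  \<open>24 / 2^i\<close> cancels their number.\<close>

lemma exp_sum_dyadic_osc:
  fixes l :: real
  assumes l: "0 \<le> l"
  obtains C where "\<And>n. integrable M (\<lambda>\<omega>. exp (l * (\<Sum>i\<le>n. dyadic_osc \<tau> (\<lambda>t. B t \<omega>) i)))"
    and "\<And>n. expectation (\<lambda>\<omega>. exp (l * (\<Sum>i\<le>n. dyadic_osc \<tau> (\<lambda>t. B t \<omega>) i))) \<le> C"
proof -
  \<comment> \<open>\<open>(r^i)^4 = 1 / 2^i\<close> serves twice: against the number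
    \<open>2^i\<close> of increments at level \<open>i\<close>, and against their variance
    \<open>\<tau> / 2^i\<close> in the Gaussian exponent.\<close>
  define r :: real where "r = root 4 (1 / 2)"
  have r4: "r^4 = 1 / 2" by (simp add: r_def)
  have r: "0 < r" "r < 1" by (simp_all add: r_def)
  have r4i: "(r^i)^4 = 1 / 2^i" for i
    using r4 by (simp add: power_one_over power_mult[symmetric] mult.commute[of i]) (simp add: power_mult r4 power_one_over)
  define q where "q = (\<lambda>i::nat. (1 - r) * r^i)"
  define \<mu> where "\<mu> = l / (1 - r)"
  have \<mu>: "0 \<le> \<mu>" using l r by (simp add: \<mu>_def)
  have q0: "0 \<le> q i" for i using r by (simp add: q_def)
  have q1: "(\<Sum>i\<le>n. q i) \<le> 1" for n
  proof -
    have "(\<Sum>i\<le>n. q i) = 1 - r^Suc n"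
      using r by (simp add: q_def flip: sum_distrib_left) (simp add: sum_gp0)
    then show ?thesis using r by simp
  qed
  define \<Delta> where "\<Delta> = (\<lambda>i k \<omega>. B (real (Suc k) * \<tau> / 2^i) \<omega> - B (real k * \<tau> / 2^i) \<omega>)"
  define D where "D = (\<lambda>i \<omega>. dyadic_osc \<tau> (\<lambda>t. B t \<omega>) i)"
  define Z where "Z = (\<lambda>i \<omega>. exp 1 + 24 / 2^i * (\<Sum>k<2^i. exp (2 * \<mu> / (r^i)\<^sup>2 * \<bar>\<Delta> i k \<omega>\<bar>)))"
  have [measurable]: "D i \<in> borel_measurable M" for i
    unfolding D_def by (rule dyadic_osc_measurable)
  have pointwise: "exp (l * (\<Sum>i\<le>n. D i \<omega>)) \<le> 1 + (\<Sum>i\<le>n. q i * Z i \<omega>)" for n \<omega>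
  proof -
    \<comment> \<open>\<open>q i * r^i * (\<mu> / (r^i)\<^sup>2) = l\<close>: one factor
      \<open>r^i\<close> belongs to the convex weight, the other is the \<open>c\<close> of
      \<open>exp_scaled_le\<close>, and \<open>\<mu>\<close> compensates for
      \<open>1 - r\<close>.\<close>
    have "l * (\<Sum>i\<le>n. D i \<omega>) = (\<Sum>i\<le>n. q i * (r^i * (\<mu> / (r^i)\<^sup>2 * D i \<omega>)))"
      using r by (simp add: q_def \<mu>_def sum_distrib_left power2_eq_square)
    also have "exp \<dots> \<le> 1 + (\<Sum>i\<le>n. q i * exp (r^i * (\<mu> / (r^i)\<^sup>2 * D i \<omega>)))"
      using q0 q1 by (intro exp_weighted_sum_le)
    also have "\<dots> \<le> 1 + (\<Sum>i\<le>n. q i * Z i \<omega>)"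
    proof (intro add_left_mono sum_mono mult_left_mono q0)
      fix i
      obtain k where k: "k < 2^i" "D i \<omega> = \<bar>\<Delta> i k \<omega>\<bar>"
        unfolding D_def \<Delta>_def by (rule dyadic_osc_attained)
      have "exp (r^i * (\<mu> / (r^i)\<^sup>2 * D i \<omega>)) \<le> exp 1 + 24 * (r^i)^4 * exp (2 * (\<mu> / (r^i)\<^sup>2 * D i \<omega>))"
        using r \<mu> k by (intro exp_scaled_le) (auto intro: power_le_one)
      also have "\<dots> = exp 1 + 24 / 2^i * exp (2 * \<mu> / (r^i)\<^sup>2 * \<bar>\<Delta> i k \<omega>\<bar>)"
        by (simp add: r4i k)
      also have "\<dots> \<le> Z i \<omega>"
        unfolding Z_def using k by (intro add_left_mono mult_left_mono member_le_sum) auto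
      finally show "exp (r^i * (\<mu> / (r^i)\<^sup>2 * D i \<omega>)) \<le> Z i \<omega>" .
    qed
    finally show ?thesis .
  qed
  \<comment> \<open>48 is 24 times the factor 2 of \<open>exp_abs_normal\<close>; the exponent is
    the level-free one computed below.\<close>
  define A where "A = exp 1 + 48 * exp (2 * \<mu>\<^sup>2 * \<tau>)"
  have Z: "integrable M (Z i)" "expectation (Z i) \<le> A" for i
  proof -
    have dist: "distributed M lborel (\<Delta> i k) (normal_density 0 (sqrt (\<tau> / 2^i)))" for k
    proof -
      have "real k * \<tau> / 2^i < real (Suc k) * \<tau> / 2^i"
        using \<tau> by (intro divide_strict_right_mono mult_strict_right_mono) auto
      moreover have "real (Suc k) * \<tau> / 2^i - real k * \<tau> / 2^i = \<tau> / 2^i"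
        by (simp add: field_simps)
      moreover have "0 \<le> real k * \<tau> / 2^i" using \<tau> by simp
      ultimately show ?thesis
        using BM unfolding standard_brownian_motion_def \<Delta>_def by metis
    qed
    have sd: "0 < sqrt (\<tau> / 2^i)" using \<tau> by simp
    note e = exp_abs_normal[OF dist sd, of "2 * \<mu> / (r^i)\<^sup>2"]
    \<comment> \<open>The square of the multiplier brings \<open>(r^i)^4\<close> into the
      denominator, where it cancels the \<open>2^i\<close> of the variance; the exponent is thus the
      same at every level.\<close>
    have "(2 * \<mu> / (r^i)\<^sup>2)\<^sup>2 * (sqrt (\<tau> / 2^i))\<^sup>2 / 2 = 2 * \<mu>\<^sup>2 * \<tau> / ((r^i)^4 * 2^i)"
      using \<tau> r by (simp add: field_simps power2_eq_square power4_eq_xxxx)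
    also have "\<dots> = 2 * \<mu>\<^sup>2 * \<tau>" by (simp add: r4i)
    finally have exponent: "(2 * \<mu> / (r^i)\<^sup>2)\<^sup>2 * (sqrt (\<tau> / 2^i))\<^sup>2 / 2 = 2 * \<mu>\<^sup>2 * \<tau>" .
    have e2: "expectation (\<lambda>\<omega>. exp (2 * \<mu> / (r^i)\<^sup>2 * \<bar>\<Delta> i k \<omega>\<bar>)) \<le> 2 * exp (2 * \<mu>\<^sup>2 * \<tau>)" for k
      using e(2)[of k] unfolding exponent .
    show "integrable M (Z i)"
      unfolding Z_def by (intro Bochner_Integration.integrable_add integrable_mult_right
          Bochner_Integration.integrable_sum e(1)) simp
    have "expectation (Z i) = exp 1 + 24 / 2^i * (\<Sum>k<2^i. expectation (\<lambda>\<omega>. exp (2 * \<mu> / (r^i)\<^sup>2 * \<bar>\<Delta> i k \<omega>\<bar>)))"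
      unfolding Z_def using e(1) by (simp add: prob_space)
    also have "\<dots> \<le> exp 1 + 24 / 2^i * (\<Sum>k<(2::nat)^i. 2 * exp (2 * \<mu>\<^sup>2 * \<tau>))"
      by (intro add_left_mono mult_left_mono sum_mono e2) simp
    also have "\<dots> = A" by (simp add: A_def)
    finally show "expectation (Z i) \<le> A" .
  qed
  have A: "0 \<le> A" by (simp add: A_def)
  have int: "integrable M (\<lambda>\<omega>. 1 + (\<Sum>i\<le>n. q i * Z i \<omega>))" for n
    using Z by simp
  have int': "integrable M (\<lambda>\<omega>. exp (l * (\<Sum>i\<le>n. D i \<omega>)))" for n
    by (rule Bochner_Integration.integrable_bound[OF int]) (use pointwise in \<open>auto intro: order.trans[OF _ abs_ge_self]\<close>)
  have "expectation (\<lambda>\<omega>. exp (l * (\<Sum>i\<le>n. D i \<omega>))) \<le> 1 + A" for n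
  proof -
    have "expectation (\<lambda>\<omega>. exp (l * (\<Sum>i\<le>n. D i \<omega>))) \<le> expectation (\<lambda>\<omega>. 1 + (\<Sum>i\<le>n. q i * Z i \<omega>))"
      by (intro integral_mono int int' pointwise)
    also have "\<dots> = 1 + (\<Sum>i\<le>n. q i * expectation (Z i))"
      using Z by (simp add: prob_space)
    also have "\<dots> \<le> 1 + (\<Sum>i\<le>n. q i * A)"
      by (intro add_left_mono sum_mono mult_left_mono Z q0)
    also have "\<dots> \<le> 1 + 1 * A"
      unfolding sum_distrib_right[symmetric] by (intro add_left_mono mult_right_mono q1 A)
    finally show ?thesis by simp
  qed
  then show ?thesis
    using that int' unfolding D_def by blast
qed

text \<open>Monotone convergence with the uniform bound. The supremum lives in
  \<open>ennreal\<close>, where it exists before anything is known about convergence of the series,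
  so its finite integral can be used to prove summability.\<close>

lemma nn_integral_SUP_exp_dyadic_osc:
  fixes l :: real
  assumes l: "0 \<le> l"
  shows "(\<integral>\<^sup>+\<omega>. (SUP n. ennreal (exp (l * (\<Sum>i\<le>n. dyadic_osc \<tau> (\<lambda>t. B t \<omega>) i)))) \<partial>M) < \<infinity>"
proof -
  note [measurable] = dyadic_osc_measurable
  obtain C where C: "\<And>n. integrable M (\<lambda>\<omega>. exp (l * (\<Sum>i\<le>n. dyadic_osc \<tau> (\<lambda>t. B t \<omega>) i)))"
    "\<And>n. expectation (\<lambda>\<omega>. exp (l * (\<Sum>i\<le>n. dyadic_osc \<tau> (\<lambda>t. B t \<omega>) i))) \<le> C"
    using exp_sum_dyadic_osc[OF l] by metis
  have "(\<integral>\<^sup>+\<omega>. (SUP n. ennreal (exp (l * (\<Sum>i\<le>n. dyadic_osc \<tau> (\<lambda>t. B t \<omega>) i)))) \<partial>M) =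
      (SUP n. \<integral>\<^sup>+\<omega>. ennreal (exp (l * (\<Sum>i\<le>n. dyadic_osc \<tau> (\<lambda>t. B t \<omega>) i))) \<partial>M)"
  proof (rule nn_integral_monotone_convergence_SUP)
    show "incseq (\<lambda>n \<omega>. ennreal (exp (l * (\<Sum>i\<le>n. dyadic_osc \<tau> (\<lambda>t. B t \<omega>) i))))"
      using l dyadic_osc_nonneg
      by (intro incseq_SucI le_funI ennreal_leI) (simp add: mult_left_mono)
  qed measurable
  also have "\<dots> \<le> ennreal C"
    using C by (intro SUP_least) (simp add: nn_integral_eq_integral ennreal_leI)
  finally show ?thesis
    by (rule le_less_trans) simp
qed

text \<open>A finite integral makes the supremum finite almost surely, and
  \<open>1 + y \<le> exp y\<close> turns this into a bound on the partial sums of a nonnegative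
  series.\<close>

lemma AE_summable_dyadic_osc: "AE \<omega> in M. summable (dyadic_osc \<tau> (\<lambda>t. B t \<omega>))"
proof -
  note [measurable] = dyadic_osc_measurable
  have "AE \<omega> in M. (SUP n. ennreal (exp (1 * (\<Sum>i\<le>n. dyadic_osc \<tau> (\<lambda>t. B t \<omega>) i)))) \<noteq> \<infinity>"
    using nn_integral_SUP_exp_dyadic_osc[of 1] by (intro nn_integral_PInf_AE) auto
  then show ?thesis
  proof eventually_elim
    fix \<omega> assume "(SUP n. ennreal (exp (1 * (\<Sum>i\<le>n. dyadic_osc \<tau> (\<lambda>t. B t \<omega>) i)))) \<noteq> \<infinity>"
    then obtain c where c: "0 \<le> c" "(SUP n. ennreal (exp (\<Sum>i\<le>n. dyadic_osc \<tau> (\<lambda>t. B t \<omega>) i))) = ennreal c"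
      by (cases "SUP n. ennreal (exp (\<Sum>i\<le>n. dyadic_osc \<tau> (\<lambda>t. B t \<omega>) i))") auto
    have "(\<Sum>i\<le>n. dyadic_osc \<tau> (\<lambda>t. B t \<omega>) i) \<le> c" for n
    proof -
      have "ennreal (exp (\<Sum>i\<le>n. dyadic_osc \<tau> (\<lambda>t. B t \<omega>) i)) \<le> ennreal c"
        unfolding c(2)[symmetric] by (rule SUP_upper) simp
      then have "exp (\<Sum>i\<le>n. dyadic_osc \<tau> (\<lambda>t. B t \<omega>) i) \<le> c" using c(1) by simp
      then show ?thesis using exp_ge_add_one_self[of "\<Sum>i\<le>n. dyadic_osc \<tau> (\<lambda>t. B t \<omega>) i"] by linarith
    qed
    then show "summable (dyadic_osc \<tau> (\<lambda>t. B t \<omega>))"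
      by (intro bounded_imp_summable[of _ c] dyadic_osc_nonneg)
  qed
qed

text \<open>On the summability event the integrand is a limit of exponentials of partial sums, hence
  below their supremum. Elsewhere \<open>suminf\<close> says nothing about the partial sums, so the
  comparison is made almost everywhere.\<close>

lemma integrable_exp_suminf_dyadic_osc:
  assumes l: "0 \<le> l"
  shows "integrable M (\<lambda>\<omega>. exp (l * (\<Sum>n. dyadic_osc \<tau> (\<lambda>t. B t \<omega>) n)))"
proof (rule integrableI_bounded)
  note [measurable] = dyadic_osc_measurable
  show "(\<lambda>\<omega>. exp (l * (\<Sum>n. dyadic_osc \<tau> (\<lambda>t. B t \<omega>) n))) \<in> borel_measurable M"
    by measurable
  have "AE \<omega> in M. ennreal (exp (l * (\<Sum>n. dyadic_osc \<tau> (\<lambda>t. B t \<omega>) n))) \<le>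
      (SUP n. ennreal (exp (l * (\<Sum>i\<le>n. dyadic_osc \<tau> (\<lambda>t. B t \<omega>) i))))"
    using AE_summable_dyadic_osc
  proof eventually_elim
    fix \<omega> assume "summable (dyadic_osc \<tau> (\<lambda>t. B t \<omega>))"
    then have "(\<lambda>n. \<Sum>i\<le>n. dyadic_osc \<tau> (\<lambda>t. B t \<omega>) i) \<longlonglongrightarrow> (\<Sum>n. dyadic_osc \<tau> (\<lambda>t. B t \<omega>) n)"
      by (rule summable_LIMSEQ')
    then have "(\<lambda>n. ennreal (exp (l * (\<Sum>i\<le>n. dyadic_osc \<tau> (\<lambda>t. B t \<omega>) i)))) \<longlonglongrightarrow>
        ennreal (exp (l * (\<Sum>n. dyadic_osc \<tau> (\<lambda>t. B t \<omega>) n)))"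
      by (intro tendsto_ennrealI tendsto_intros)
    then show "ennreal (exp (l * (\<Sum>n. dyadic_osc \<tau> (\<lambda>t. B t \<omega>) n))) \<le>
        (SUP n. ennreal (exp (l * (\<Sum>i\<le>n. dyadic_osc \<tau> (\<lambda>t. B t \<omega>) i))))"
      by (rule LIMSEQ_le_const2) (intro exI allI impI SUP_upper UNIV_I)
  qed
  then have "(\<integral>\<^sup>+\<omega>. ennreal (exp (l * (\<Sum>n. dyadic_osc \<tau> (\<lambda>t. B t \<omega>) n))) \<partial>M) \<le>
      (\<integral>\<^sup>+\<omega>. (SUP n. ennreal (exp (l * (\<Sum>i\<le>n. dyadic_osc \<tau> (\<lambda>t. B t \<omega>) i)))) \<partial>M)"
    by (rule nn_integral_mono_AE)
  also have "\<dots> < \<infinity>" by (rule nn_integral_SUP_exp_dyadic_osc[OF l])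
  finally show "(\<integral>\<^sup>+\<omega>. ennreal (norm (exp (l * (\<Sum>n. dyadic_osc \<tau> (\<lambda>t. B t \<omega>) n)))) \<partial>M) < \<infinity>"
    by simp
qed

end

section \<open>Unboundedness of the regularized motion\<close>

text \<open>Uniform continuity makes the error on each cell at most \<open>e' * h\<close>, and
  induction over the cells adds this up to \<open>e' * t\<close>. Right endpoints suit the Gaussian
  application: the Brownian value there is the sum of all increments up to the same index.\<close>

lemma riemann_sum_tendsto_integral:
  fixes f :: "real \<Rightarrow> real"
  assumes f: "continuous_on {0..t} f" and t: "0 \<le> t"
  shows "(\<lambda>N. \<Sum>k<N. f (real (Suc k) * (t / real N)) * (t / real N)) \<longlonglongrightarrow> integral {0..t} f"
proof (rule LIMSEQ_I)
  fix e :: real assume e: "0 < e"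
  \<comment> \<open>The \<open>+ 1\<close> covers \<open>t = 0\<close>.\<close>
  define e' where "e' = e / (2 * (t + 1))"
  have e': "0 < e'" "e' * t < e"
    using e t by (auto simp: e'_def field_simps intro: add_nonneg_pos)
  have "uniformly_continuous_on {0..t} f"
    using f by (intro compact_uniformly_continuous) auto
  then obtain d where d: "0 < d" "\<And>x y. x \<in> {0..t} \<Longrightarrow> y \<in> {0..t} \<Longrightarrow> dist y x < d \<Longrightarrow> dist (f y) (f x) < e'"
    using e' unfolding uniformly_continuous_on_def by metis
  obtain N0 :: nat where N0: "t / d < real N0" using reals_Archimedean2 by blast
  show "\<exists>N0. \<forall>N\<ge>N0. norm ((\<Sum>k<N. f (real (Suc k) * (t / real N)) * (t / real N)) - integral {0..t} f) < e"
  proof (intro exI allI impI)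
    \<comment> \<open>The witness \<open>Suc N0\<close> excludes \<open>N = 0\<close>, and
      \<open>t / d < real N\<close> makes the mesh smaller than \<open>d\<close>.\<close>
    fix N assume "N \<ge> Suc N0"
    then have N: "0 < N" "t / d < real N" using N0 by auto
    define h where "h = t / real N"
    have h: "0 \<le> h" "h < d" "real N * h = t"
      using t d N by (auto simp: h_def field_simps)
    have "\<bar>(\<Sum>k<m. f (real (Suc k) * h) * h) - integral {0..real m * h} f\<bar> \<le> real m * (e' * h)" if "m \<le> N" for m
      using that
    proof (induction m)
      case (Suc m)
      have "real (Suc m) * h \<le> real N * h" using Suc.prems h by (intro mult_right_mono) auto
      then have le: "real (Suc m) * h \<le> t" "real m * h \<le> real (Suc m) * h" "0 \<le> real m * h"
        using h by (auto simp: algebra_simps)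
      have "f integrable_on {0..real (Suc m) * h}"
        using le by (intro integrable_continuous_interval continuous_on_subset[OF f]) auto
      then have split: "integral {0..real m * h} f + integral {real m * h..real (Suc m) * h} f = integral {0..real (Suc m) * h} f"
        using le by (intro Henstock_Kurzweil_Integration.integral_combine) auto
      have sub: "{real m * h..real (Suc m) * h} \<subseteq> {0..t}"
        using le unfolding atLeastatMost_subset_iff by blast
      have int: "f integrable_on {real m * h..real (Suc m) * h}"
        by (rule integrable_continuous_interval[OF continuous_on_subset[OF f sub]])
      have c: "continuous_on {real m * h..real (Suc m) * h} (\<lambda>x. f (real (Suc m) * h) - f x)"
        by (intro continuous_intros continuous_on_subset[OF f sub])
      have "norm (integral {real m * h..real (Suc m) * h} (\<lambda>x. f (real (Suc m) * h) - f x)) \<le> e' * (real (Suc m) * h - real m * h)"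
      proof (rule integral_bound[OF le(2) c])
        fix x assume x: "x \<in> {real m * h..real (Suc m) * h}"
        have in_t: "x \<in> {0..t}" "real (Suc m) * h \<in> {0..t}"
          using x le by auto
        have "dist (real (Suc m) * h) x < d"
          using x h by (auto simp: dist_real_def algebra_simps)
        then show "norm (f (real (Suc m) * h) - f x) \<le> e'"
          using d(2)[OF in_t] by (simp add: dist_real_def)
      qed
      moreover have "integral {real m * h..real (Suc m) * h} (\<lambda>x. f (real (Suc m) * h) - f x) =
          f (real (Suc m) * h) * h - integral {real m * h..real (Suc m) * h} f"
        by (subst Henstock_Kurzweil_Integration.integral_diff[OF integrable_const_ivl int])
          (use le in \<open>simp add: algebra_simps\<close>)
      ultimately have "\<bar>f (real (Suc m) * h) * h - integral {real m * h..real (Suc m) * h} f\<bar> \<le> e' * h"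
        by (simp add: algebra_simps)
      moreover have "\<bar>(\<Sum>k<m. f (real (Suc k) * h) * h) - integral {0..real m * h} f\<bar> \<le> real m * (e' * h)"
        using Suc by simp
      moreover have "real (Suc m) * (e' * h) = real m * (e' * h) + e' * h"
        by (simp add: algebra_simps)
      ultimately show ?case
        using split unfolding sum.lessThan_Suc by linarith
    qed simp
    from this[of N] have "\<bar>(\<Sum>k<N. f (real (Suc k) * h) * h) - integral {0..t} f\<bar> \<le> e' * t"
      using h by (simp add: mult.left_commute)
    then show "norm ((\<Sum>k<N. f (real (Suc k) * (t / real N)) * (t / real N)) - integral {0..t} f) < e"
      using e' unfolding h_def[symmetric] by simp
  qed
qed

text \<open>Discrete form of the integral of \<open>x\<^sup>2\<close> over \<open>[0, N]\<close>. It
  serves to bound a Gaussian variance from below, where \<open>N^3\<close> cancels three factors of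
  the mesh \<open>t / N\<close>.\<close>

lemma sum_squares_ge: "real N ^ 3 / 3 \<le> (\<Sum>j<N. (real N - real j)\<^sup>2)"
proof (induction N)
  case (Suc N)
  have "(\<Sum>j<Suc N. (real (Suc N) - real j)\<^sup>2) = (real (Suc N))\<^sup>2 + (\<Sum>j<N. (real N - real j)\<^sup>2)"
    by (simp add: sum.lessThan_Suc_shift del: sum.lessThan_Suc)
  moreover have "real (Suc N) ^ 3 / 3 \<le> (real (Suc N))\<^sup>2 + real N ^ 3 / 3"
    by (simp add: power2_eq_square power3_eq_cube algebra_simps)
  ultimately show ?case using Suc.IH by linarith
qed simp

text \<open>Summation by parts: a weighted sum of path values becomes a weighted sum of increments,
  which are independent for Brownian motion.\<close>

lemma sum_mult_partial_sums:
  fixes w \<Delta> :: "nat \<Rightarrow> real"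
  shows "(\<Sum>k<N. w k * (\<Sum>j\<le>k. \<Delta> j)) = (\<Sum>j<N. (\<Sum>k=j..<N. w k) * \<Delta> j)"
proof (induction N)
  case (Suc N)
  have "(\<Sum>j<N. (\<Sum>k=j..<Suc N. w k) * \<Delta> j) = (\<Sum>j<N. (\<Sum>k=j..<N. w k) * \<Delta> j) + (\<Sum>j<N. w N * \<Delta> j)"
    unfolding sum.distrib[symmetric] by (intro sum.cong) (auto simp: algebra_simps)
  then show ?case
    using Suc by (simp add: algebra_simps sum_distrib_left flip: lessThan_Suc_atMost)
qed simp

text \<open>After rescaling to the standard normal the threshold is
  \<open>a / \<sigma> \<le> a / s\<close>, because \<open>0 \<le> a\<close>. The standard tail
  beyond \<open>a / s\<close> is therefore a common lower bound, and it is positive because the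
  density is.\<close>

lemma (in prob_space) normal_tail_lower_bound:
  fixes a s :: real
  assumes "0 \<le> a" "0 < s"
  obtains p where "0 < p" "\<And>X \<sigma>. distributed M lborel X (normal_density 0 \<sigma>) \<Longrightarrow> s \<le> \<sigma> \<Longrightarrow>
    p \<le> prob {\<omega>\<in>space M. a < X \<omega>}"
proof -
  define I where "I = (\<integral>\<^sup>+x. ennreal (std_normal_density x) * indicator {a / s<..} x \<partial>lborel)"
  have "I \<noteq> 0"
  proof
    assume "I = 0"
    then have "AE x in lborel. ennreal (std_normal_density x) * indicator {a / s<..} x = 0"
      unfolding I_def by (subst (asm) nn_integral_0_iff_AE) auto
    then have "AE x in lborel. x \<notin> {a / s<..}"
      by eventually_elim (use normal_density_pos[of 1 0] in \<open>auto simp: indicator_def ennreal_eq_0_iff not_le[symmetric] split: if_splits\<close>)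
    then have "emeasure lborel {a / s<..} = 0"
      by (subst (asm) AE_iff_measurable[where N="{a / s<..}"]) auto
    moreover have "emeasure lborel {a / s<..a / s + 1} \<le> emeasure lborel {a / s<..}"
      by (intro emeasure_mono) auto
    ultimately show False by simp
  qed
  have le: "I \<le> emeasure M {\<omega>\<in>space M. a < X \<omega>}"
    if X: "distributed M lborel X (normal_density 0 \<sigma>)" and \<sigma>: "s \<le> \<sigma>" for X \<sigma>
  proof -
    have [measurable]: "X \<in> borel_measurable M"
      using distributed_measurable[OF X] by simp
    have "0 < \<sigma>" using \<sigma> assms by simp
    then have "distributed M lborel (\<lambda>\<omega>. X \<omega> / \<sigma>) std_normal_density"
      using normal_standard_normal_convert[of \<sigma> X 0] X by simp
    from distributed_emeasure[OF this, of "{a / s<..}"]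
    have "I = emeasure M ((\<lambda>\<omega>. X \<omega> / \<sigma>) -` {a / s<..} \<inter> space M)"
      by (simp add: I_def)
    also have "\<dots> \<le> emeasure M {\<omega>\<in>space M. a < X \<omega>}"
    proof (intro emeasure_mono subsetI)
      fix \<omega> assume "\<omega> \<in> (\<lambda>\<omega>. X \<omega> / \<sigma>) -` {a / s<..} \<inter> space M"
      then have \<omega>: "\<omega> \<in> space M" "a / s < X \<omega> / \<sigma>" by auto
      have "a / \<sigma> \<le> a / s" using assms \<sigma> \<open>0 < \<sigma>\<close> by (intro divide_left_mono) auto
      then have "a / \<sigma> < X \<omega> / \<sigma>" using \<omega> by linarith
      then show "\<omega> \<in> {\<omega>\<in>space M. a < X \<omega>}" using \<omega> \<open>0 < \<sigma>\<close> by (simp add: divide_less_cancel)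
    qed measurable
    finally show ?thesis .
  qed
  show ?thesis
  proof (cases "I = \<infinity>")
    \<comment> \<open>\<open>I = \<infinity>\<close> contradicts the finiteness of a probability for
      any admissible \<open>X\<close>, so any positive number will do.\<close>
    case True
    show ?thesis
      by (rule that[of 1]) (use le True in \<open>auto simp: top_unique\<close>)
  next
    case False
    then obtain p where p: "I = ennreal p" "0 \<le> p" by (cases I) auto
    show ?thesis
      using p le \<open>I \<noteq> 0\<close> by (intro that[of p]) (auto simp: emeasure_eq_measure order_less_le)
  qed
qed

text \<open>
  The Riemann sums of \<open>\<integral>\<^sub>0\<^sup>t k(t-u) B\<^sub>u du\<close> are centred Gaussian with variances bounded away from zero,
  so their upper tails cannot vanish in the limit.
\<close>

lemma brownian_Volterra_unbounded:
  fixes a :: real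
  assumes BM: "standard_brownian_motion M B" and t: "0 < t"
    and k: "continuous_on {0..t} k" "\<And>s. s \<in> {0..t} \<Longrightarrow> 0 < k s"
  shows "\<not> (AE \<omega> in M. integral {0..t} (\<lambda>u. k (t - u) * B u \<omega>) \<le> a)"
proof
  interpret prob_space M using BM by (simp add: standard_brownian_motion_def)
  assume bounded: "AE \<omega> in M. integral {0..t} (\<lambda>u. k (t - u) * B u \<omega>) \<le> a"
  have increments: "\<And>(n::nat) (t::nat \<Rightarrow> real). 0 \<le> t 0 \<and> (\<forall>i<n. t i \<le> t (Suc i)) \<Longrightarrow>
      indep_vars (\<lambda>_. borel) (\<lambda>i \<omega>. B (t (Suc i)) \<omega> - B (t i) \<omega>) {..<n}"
    using BM by (simp add: standard_brownian_motion_def)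
  obtain x where "x \<in> {0..t}" "\<And>y. y \<in> {0..t} \<Longrightarrow> k x \<le> k y"
    using continuous_attains_inf[OF _ _ k(1)] t by fastforce
  then obtain m where m: "0 < m" "\<And>y. y \<in> {0..t} \<Longrightarrow> m \<le> k y"
    using k(2) by blast
  define h where "h = (\<lambda>N::nat. t / real N)"
  define w where "w = (\<lambda>N j. k (t - real (Suc j) * h N))"
  \<comment> \<open>Coefficient of the \<open>j\<close>-th increment once the Riemann sum with
    kernel weights \<open>w\<close> has been summed by parts.\<close>
  define c where "c = (\<lambda>N j. h N * (\<Sum>i=j..<N. w N i))"
  define \<Delta> where "\<Delta> = (\<lambda>N j \<omega>. B (real (Suc j) * h N) \<omega> - B (real j * h N) \<omega>)"
  define X where "X = (\<lambda>N \<omega>. \<Sum>j<N. c N j * \<Delta> N j \<omega>)"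
  have h: "0 < h N" "real N * h N = t" if "0 < N" for N
    using t that by (auto simp: h_def)
  have w: "m \<le> w N j" if "j < N" for N j
  proof -
    have "real (Suc j) * h N \<le> real N * h N"
      using that h(1)[of N] by (intro mult_right_mono) auto
    then show ?thesis
      unfolding w_def using that h[of N] by (intro m) auto
  qed
  have c: "h N * m * (real N - real j) \<le> c N j" if "j < N" for N j
  proof -
    have "m * (real N - real j) = (\<Sum>i=j..<N. m)" using that by (simp add: of_nat_diff)
    also have "\<dots> \<le> (\<Sum>i=j..<N. w N i)" by (intro sum_mono w) auto
    finally show ?thesis unfolding c_def using h(1)[of N] that by simp
  qed
  have c_pos: "0 < c N j" if "j < N" for N j
    using c[OF that] h(1)[of N] m(1) that by (intro less_le_trans[OF _ c]) auto
  \<comment> \<open>Lower bound for all standard deviations: \<open>c N j\<close> is at least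
    \<open>h N * m * (N - j)\<close>, each increment has variance \<open>h N\<close>, the squares
    contribute \<open>N^3 / 3\<close>, and \<open>N * h N = t\<close>.\<close>
  define s where "s = sqrt (m\<^sup>2 * t^3 / 3)"
  have s: "0 < s" using m t by (simp add: s_def)
  have X_normal: "\<exists>\<sigma>\<ge>s. distributed M lborel (X N) (normal_density 0 \<sigma>)" if N: "0 < N" for N
  proof -
    have dist: "distributed M lborel (\<lambda>\<omega>. c N j * \<Delta> N j \<omega>) (normal_density 0 (c N j * sqrt (h N)))" if "j < N" for j
    proof -
      have "real j * h N < real (Suc j) * h N" "0 \<le> real j * h N"
        "real (Suc j) * h N - real j * h N = h N"
        using h[OF N] by (auto simp: algebra_simps)
      then have "distributed M lborel (\<Delta> N j) (normal_density 0 (sqrt (h N)))"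
        using BM unfolding standard_brownian_motion_def \<Delta>_def by metis
      from normal_density_affine[OF this, of "c N j" 0] show ?thesis
        using h[OF N] c_pos[OF that] by simp
    qed
    have "indep_vars (\<lambda>_. borel) (\<Delta> N) {..<N}"
    proof -
      have "0 \<le> real 0 * h N \<and> (\<forall>i<N. real i * h N \<le> real (Suc i) * h N)"
        using h[OF N] by (auto simp: algebra_simps)
      then show ?thesis
        using increments[of "\<lambda>i. real i * h N" N] unfolding \<Delta>_def by blast
    qed
    then have indep: "indep_vars (\<lambda>_. borel) (\<lambda>j \<omega>. c N j * \<Delta> N j \<omega>) {..<N}"
      by (rule indep_vars_compose2[where Y="\<lambda>j x. c N j * x"]) measurable
    have D: "distributed M lborel (X N) (normal_density (\<Sum>j<N. 0) (sqrt (\<Sum>j<N. (c N j * sqrt (h N))\<^sup>2)))"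
      unfolding X_def using N c_pos h[OF N] dist indep by (intro sum_indep_normal) auto
    have "m\<^sup>2 * t^3 / 3 = (h N * m)\<^sup>2 * h N * (real N ^ 3 / 3)"
      by (simp add: h(2)[OF N, symmetric] power_mult_distrib power2_eq_square power3_eq_cube algebra_simps)
    also have "\<dots> \<le> (h N * m)\<^sup>2 * h N * (\<Sum>j<N. (real N - real j)\<^sup>2)"
      using h[OF N] by (intro mult_left_mono sum_squares_ge) auto
    also have "\<dots> = (\<Sum>j<N. (h N * m * (real N - real j))\<^sup>2 * h N)"
      by (simp add: sum_distrib_left power_mult_distrib mult_ac)
    also have "\<dots> \<le> (\<Sum>j<N. (c N j)\<^sup>2 * h N)"
      using c h[OF N] m by (intro sum_mono mult_right_mono power_mono) auto
    also have "\<dots> = (\<Sum>j<N. (c N j * sqrt (h N))\<^sup>2)"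
      using h[OF N] by (simp add: power_mult_distrib)
    finally show ?thesis
      using D by (intro exI[of _ "sqrt (\<Sum>j<N. (c N j * sqrt (h N))\<^sup>2)"]) (simp add: s_def)
  qed
  have [measurable]: "X N \<in> borel_measurable M" for N
  proof (cases "N = 0")
    case True then show ?thesis by (simp add: X_def)
  next
    case False
    then show ?thesis using X_normal[of N] distributed_measurable by fastforce
  qed
  have conv: "AE \<omega> in M. (\<lambda>N. X N \<omega>) \<longlonglongrightarrow> integral {0..t} (\<lambda>u. k (t - u) * B u \<omega>)"
  proof -
    have "AE \<omega> in M. B 0 \<omega> = 0" "AE \<omega> in M. continuous_on {0..} (\<lambda>t. B t \<omega>)"
      using BM by (simp_all add: standard_brownian_motion_def)
    then show ?thesis
    proof eventually_elim
      fix \<omega> assume B0: "B 0 \<omega> = 0" and B: "continuous_on {0..} (\<lambda>t. B t \<omega>)"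
      have "continuous_on {0..t} (\<lambda>u. k (t - u) * B u \<omega>)"
        by (auto intro!: continuous_intros continuous_on_compose2[OF k(1)] continuous_on_subset[OF B])
      from riemann_sum_tendsto_integral[OF this] t
      have "(\<lambda>N. \<Sum>j<N. k (t - real (Suc j) * h N) * B (real (Suc j) * h N) \<omega> * h N) \<longlonglongrightarrow>
          integral {0..t} (\<lambda>u. k (t - u) * B u \<omega>)"
        by (simp add: h_def)
      also have "(\<lambda>N. \<Sum>j<N. k (t - real (Suc j) * h N) * B (real (Suc j) * h N) \<omega> * h N) = (\<lambda>N. X N \<omega>)"
      proof
        fix N
        \<comment> \<open>The increments telescope to the value at the right endpoint because the
          path starts at 0.\<close>
        have "(\<Sum>i\<le>j. \<Delta> N i \<omega>) = B (real (Suc j) * h N) \<omega>" for j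
          using sum_lessThan_telescope[of "\<lambda>i. B (real i * h N) \<omega>" "Suc j"] B0
          by (simp add: \<Delta>_def lessThan_Suc_atMost)
        then have "(\<Sum>j<N. k (t - real (Suc j) * h N) * B (real (Suc j) * h N) \<omega> * h N) =
            h N * (\<Sum>j<N. w N j * (\<Sum>i\<le>j. \<Delta> N i \<omega>))"
          by (simp add: w_def sum_distrib_left mult_ac)
        also have "\<dots> = X N \<omega>"
          unfolding sum_mult_partial_sums by (simp add: X_def c_def sum_distrib_left mult_ac)
        finally show "(\<Sum>j<N. k (t - real (Suc j) * h N) * B (real (Suc j) * h N) \<omega> * h N) = X N \<omega>" .
      qed
      finally show "(\<lambda>N. X N \<omega>) \<longlonglongrightarrow> integral {0..t} (\<lambda>u. k (t - u) * B u \<omega>)" .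
    qed
  qed
  \<comment> \<open>Nonnegative, as the tail bound asks, and strictly above \<open>a\<close>, so
    that a limit of at most \<open>a\<close> forces the indicators below to vanish
    eventually.\<close>
  define a' where "a' = max a 0 + 1"
  obtain p where p: "0 < p" "\<And>X \<sigma>. distributed M lborel X (normal_density 0 \<sigma>) \<Longrightarrow> s \<le> \<sigma> \<Longrightarrow>
      p \<le> prob {\<omega>\<in>space M. a' < X \<omega>}"
    using normal_tail_lower_bound[of a' s] s by (auto simp: a'_def)
  \<comment> \<open>Dominated convergence sends the tail probabilities of the Riemann sums to 0,
    against their uniform lower bound \<open>p\<close>.\<close>
  have "(\<lambda>N. LINT \<omega>|M. indicator {\<omega>\<in>space M. a' < X N \<omega>} \<omega> :: real) \<longlonglongrightarrow> (LINT \<omega>|M. 0)"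
  proof (rule integral_dominated_convergence[where w="\<lambda>_. 1"])
    show "AE \<omega> in M. (\<lambda>N. indicator {\<omega>\<in>space M. a' < X N \<omega>} \<omega> :: real) \<longlonglongrightarrow> 0"
      using conv bounded
    proof eventually_elim
      fix \<omega> assume X: "(\<lambda>N. X N \<omega>) \<longlonglongrightarrow> integral {0..t} (\<lambda>u. k (t - u) * B u \<omega>)"
        and "integral {0..t} (\<lambda>u. k (t - u) * B u \<omega>) \<le> a"
      then have "integral {0..t} (\<lambda>u. k (t - u) * B u \<omega>) < a'" by (simp add: a'_def)
      from order_tendstoD(2)[OF X this]
      show "(\<lambda>N. indicator {\<omega>\<in>space M. a' < X N \<omega>} \<omega> :: real) \<longlonglongrightarrow> 0"
        by (intro tendsto_eventually) (auto elim: eventually_mono)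
    qed
  qed (auto simp: indicator_def)
  then have "(\<lambda>N. prob {\<omega>\<in>space M. a' < X N \<omega>}) \<longlonglongrightarrow> 0" by simp
  then have "\<forall>\<^sub>F N in sequentially. prob {\<omega>\<in>space M. a' < X N \<omega>} < p"
    using p(1) by (rule order_tendstoD)
  moreover have "\<forall>\<^sub>F N in sequentially. p \<le> prob {\<omega>\<in>space M. a' < X N \<omega>}"
    using eventually_gt_at_top[of 0] by eventually_elim (metis X_normal p(2))
  ultimately have "\<forall>\<^sub>F N in sequentially. False" by eventually_elim simp
  then show False by simp
qed

section \<open>The flow\<close>

text \<open>Passage from the Lebesgue integral of the definition to the gauge integral in which the
  Volterra lemmas are stated.\<close>

lemma regularize_eq_integral:
  assumes "continuous_on {0..} (\<lambda>t. B t \<omega>)"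
  shows "regularize \<epsilon> B t \<omega> = integral {0..t} (\<lambda>u. scaled_mollifier \<epsilon> (t - u) * B u \<omega>)"
proof -
  obtain k' where "\<And>s. (scaled_mollifier \<epsilon> has_real_derivative k' s) (at s)"
    using scaled_mollifier_C1 by metis
  then have k: "continuous_on UNIV (scaled_mollifier \<epsilon>)"
    by (meson DERIV_isCont continuous_at_imp_continuous_on)
  have "continuous_on {0..t} (\<lambda>u. scaled_mollifier \<epsilon> (t - u) * B u \<omega>)"
    by (auto intro!: continuous_intros continuous_on_compose2[OF k] continuous_on_subset[OF assms])
  then show ?thesis
    unfolding regularize_def
    by (intro set_borel_integral_eq_integral(2) borel_integrable_atLeastAtMost')
qed

lemma abs_Volterra_le:
  fixes \<phi> b :: "real \<Rightarrow> real"
  assumes \<phi>: "continuous_on {0..\<tau>} \<phi>" "\<And>s. s \<in> {0..\<tau>} \<Longrightarrow> \<bar>\<phi> s\<bar> \<le> K"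
    and b: "continuous_on {0..\<tau>} b" "\<And>s. s \<in> {0..\<tau>} \<Longrightarrow> \<bar>b s\<bar> \<le> S"
    and t: "t \<in> {0..\<tau>}"
  shows "\<bar>integral {0..t} (\<lambda>u. \<phi> (t - u) * b u)\<bar> \<le> K * \<tau> * S"
proof -
  have "0 \<in> {0..\<tau>}" using t by simp
  then have K: "0 \<le> K" "0 \<le> S"
    using \<phi>(2)[of 0] b(2)[of 0] by linarith+
  have "norm (integral {0..t} (\<lambda>u. \<phi> (t - u) * b u)) \<le> K * S * (t - 0)"
  proof (rule integral_bound)
    show "continuous_on {0..t} (\<lambda>u. \<phi> (t - u) * b u)"
      using t by (auto intro!: continuous_intros continuous_on_compose2[OF \<phi>(1)] continuous_on_subset[OF b(1)])
    show "norm (\<phi> (t - u) * b u) \<le> K * S" if "u \<in> {0..t}" for u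
      using that t K \<phi>(2)[of "t - u"] b(2)[of u] by (auto simp: abs_mult intro!: mult_mono)
  qed (use t in auto)
  also have "\<dots> \<le> K * S * \<tau>" using t K by (intro mult_left_mono) auto
  finally show ?thesis by (simp add: mult_ac)
qed

text \<open>\<open>max_le\<close> asks for an attained maximum. On the sphere \<open>f\<close>
  depends on time only, so a maximiser of \<open>g\<close> on the compact interval, paired with any
  unit vector, attains it.\<close>

lemma max_le_time_sphere:
  fixes f :: "real \<Rightarrow> real^2 \<Rightarrow> real"
  assumes g: "continuous_on {0..\<tau>} g" and \<tau>: "0 \<le> \<tau>"
    and f: "\<And>t x. t \<in> {0..\<tau>} \<Longrightarrow> x \<in> sphere 0 1 \<Longrightarrow> f t x = g t"
    and c: "\<And>t. t \<in> {0..\<tau>} \<Longrightarrow> g t \<le> c"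
  shows "max_le (\<lambda>(t, x). f t x) ({0..\<tau>} \<times> sphere 0 1) c"
proof -
  obtain t where t: "t \<in> {0..\<tau>}" "\<And>s. s \<in> {0..\<tau>} \<Longrightarrow> g s \<le> g t"
    using continuous_attains_sup[OF _ _ g] \<tau> by fastforce
  obtain x :: "real^2" where x: "x \<in> sphere 0 1"
    using vector_choose_size[of 1] by auto
  show ?thesis
    unfolding max_le_def by (rule bexI[of _ "(t, x)"]) (use t x f c in auto)
qed

lemma norm_flow: "x \<in> sphere 0 1 \<Longrightarrow> norm (flow \<epsilon> B \<omega> t x) = exp (regularize \<epsilon> B t \<omega>)"
  by (simp add: flow_def)

lemma matrix_opnorm_flow_jacobian:
  "matrix_opnorm (flow_jacobian \<epsilon> B \<omega> t x) = exp (regularize \<epsilon> B t \<omega>)"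
proof -
  have "matrix_opnorm (flow_jacobian \<epsilon> B \<omega> t x) = onorm (\<lambda>v::real^2. exp (regularize \<epsilon> B t \<omega>) *\<^sub>R v)"
    unfolding matrix_opnorm_def flow_jacobian_eq scaleR_matrix_vector_assoc[symmetric] by simp
  also have "\<dots> = exp (regularize \<epsilon> B t \<omega>)"
    using onorm_scaleR[of "\<lambda>v::real^2. v" "exp (regularize \<epsilon> B t \<omega>)"] by (simp add: onorm_id)
  finally show ?thesis .
qed

lemma flow_has_vector_derivative:
  assumes k: "\<And>s. (scaled_mollifier \<epsilon> has_real_derivative k' s) (at s)" "continuous_on UNIV k'"
    and B: "continuous_on {0..} (\<lambda>t. B t \<omega>)" and t: "t \<in> {0..\<tau>}"
  shows "((\<lambda>s. flow \<epsilon> B \<omega> s x) has_vector_derivative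
      (exp (regularize \<epsilon> B t \<omega>) *
        (scaled_mollifier \<epsilon> 0 * B t \<omega> + integral {0..t} (\<lambda>u. k' (t - u) * B u \<omega>))) *\<^sub>R x)
      (at t within {0..\<tau>})"
proof -
  have "continuous_on {0..\<tau>} (\<lambda>t. B t \<omega>)"
    by (rule continuous_on_subset[OF B]) auto
  from has_real_derivative_Volterra[OF k this t]
  have "((\<lambda>t. regularize \<epsilon> B t \<omega>) has_real_derivative
      scaled_mollifier \<epsilon> 0 * B t \<omega> + integral {0..t} (\<lambda>u. k' (t - u) * B u \<omega>)) (at t within {0..\<tau>})"
    by (simp add: regularize_eq_integral[of B \<omega>, OF B])
  from DERIV_chain2[OF DERIV_exp this] show ?thesis
    unfolding flow_def
    using has_vector_derivative_scaleR[OF _ has_vector_derivative_const[of x]] by fastforce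
qed

lemma in_Lp_exp:
  assumes S: "S \<in> borel_measurable M" and int: "\<And>l::real. 0 \<le> l \<Longrightarrow> integrable M (\<lambda>\<omega>. exp (l * S \<omega>))"
    and "0 \<le> c" "1 \<le> p"
  shows "in_Lp M p (\<lambda>\<omega>. exp (c * S \<omega>))"
proof -
  have "\<bar>exp (c * S \<omega>)\<bar> powr p = exp (p * c * S \<omega>)" for \<omega>
    by (simp add: exp_powr_real mult_ac)
  then show ?thesis
    unfolding in_Lp_def using S int[of "p * c"] assms(3,4) by simp
qed

text \<open>One variable \<open>C1\<close> dominates both the flow and its Jacobian, since on the
  sphere both norms equal \<open>exp\<close> of the regularized motion.\<close>

lemma flow_Lp_bounds:
  fixes M :: "'a measure" and B :: "real \<Rightarrow> 'a \<Rightarrow> real" and \<tau> \<epsilon> :: real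
  assumes BM: "standard_brownian_motion M B" and \<tau>: "0 < \<tau>" and \<epsilon>: "0 < \<epsilon>"
  obtains C1 C3 :: "'a \<Rightarrow> real" where
    "C1 \<in> borel_measurable M" "C3 \<in> borel_measurable M"
    "AE \<omega> in M.
       max_le (\<lambda>(t, x). norm (flow \<epsilon> B \<omega> t x)) ({0..\<tau>} \<times> sphere 0 1) (C1 \<omega>) \<and>
       max_le (\<lambda>(t, x). matrix_opnorm (flow_jacobian \<epsilon> B \<omega> t x)) ({0..\<tau>} \<times> sphere 0 1) (C1 \<omega>) \<and>
       (\<forall>t\<in>{0..\<tau>}. \<forall>x\<in>sphere 0 1.
          (\<lambda>s. flow \<epsilon> B \<omega> s x) differentiable (at t within {0..\<tau>})) \<and>
       max_le (\<lambda>(t, x). norm (flow_dt \<tau> \<epsilon> B \<omega> t x)) ({0..\<tau>} \<times> sphere 0 1) (C3 \<omega>)"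
    "\<And>p. 1 \<le> p \<Longrightarrow> in_Lp M p C1" "\<And>p. 1 \<le> p \<Longrightarrow> in_Lp M p C3"
proof -
  obtain k' where k: "\<And>s. (scaled_mollifier \<epsilon> has_real_derivative k' s) (at s)" "continuous_on UNIV k'"
    using scaled_mollifier_C1 by metis
  have kc: "continuous_on {0..\<tau>} (scaled_mollifier \<epsilon>)" "continuous_on {0..\<tau>} k'"
    using k by (meson DERIV_isCont continuous_at_imp_continuous_on, meson continuous_on_subset top_greatest)
  have bnd: "\<exists>K. \<forall>s\<in>{0..\<tau>}. \<bar>\<phi> s\<bar> \<le> K" if "continuous_on {0..\<tau>} \<phi>" for \<phi> :: "real \<Rightarrow> real"
    using compact_imp_bounded[OF compact_continuous_image[OF that compact_Icc]]
    by (auto simp: bounded_iff)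
  obtain K where K: "\<And>s. s \<in> {0..\<tau>} \<Longrightarrow> \<bar>scaled_mollifier \<epsilon> s\<bar> \<le> K"
    using bnd[OF kc(1)] by blast
  obtain L where L: "\<And>s. s \<in> {0..\<tau>} \<Longrightarrow> \<bar>k' s\<bar> \<le> L"
    using bnd[OF kc(2)] by blast
  have KL: "0 \<le> K" "0 \<le> L"
    using K[of 0] L[of 0] \<tau> by auto
  define S where "S = (\<lambda>\<omega>. \<Sum>n. dyadic_osc \<tau> (\<lambda>t. B t \<omega>) n)"
  \<comment> \<open>\<open>a\<close> bounds the convolution: kernel at most \<open>K\<close>,
    interval at most \<open>\<tau>\<close>. In \<open>b\<close>, the summand \<open>K\<close> comes
    from the boundary term of the time derivative and \<open>L * \<tau>\<close> from the integral
    against \<open>k'\<close>.\<close>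
  define a where "a = K * \<tau>"
  define b where "b = K + L * \<tau>"
  have ab: "0 \<le> a" "0 \<le> b" using KL \<tau> by (auto simp: a_def b_def)
  have S [measurable]: "S \<in> borel_measurable M"
    unfolding S_def using dyadic_osc_measurable[OF BM \<tau>] by measurable
  have S_int: "integrable M (\<lambda>\<omega>. exp (l * S \<omega>))" if "0 \<le> l" for l
    unfolding S_def by (rule integrable_exp_suminf_dyadic_osc[OF BM \<tau> that])
  show ?thesis
  proof (rule that[of "\<lambda>\<omega>. exp (a * S \<omega>)" "\<lambda>\<omega>. exp ((a + b) * S \<omega>)"])
    have "AE \<omega> in M. B 0 \<omega> = 0" "AE \<omega> in M. continuous_on {0..} (\<lambda>t. B t \<omega>)"
      using BM by (simp_all add: standard_brownian_motion_def)
    with AE_summable_dyadic_osc[OF BM \<tau>]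
    show "AE \<omega> in M.
       max_le (\<lambda>(t, x). norm (flow \<epsilon> B \<omega> t x)) ({0..\<tau>} \<times> sphere 0 1) (exp (a * S \<omega>)) \<and>
       max_le (\<lambda>(t, x). matrix_opnorm (flow_jacobian \<epsilon> B \<omega> t x)) ({0..\<tau>} \<times> sphere 0 1) (exp (a * S \<omega>)) \<and>
       (\<forall>t\<in>{0..\<tau>}. \<forall>x\<in>sphere 0 1.
          (\<lambda>s. flow \<epsilon> B \<omega> s x) differentiable (at t within {0..\<tau>})) \<and>
       max_le (\<lambda>(t, x). norm (flow_dt \<tau> \<epsilon> B \<omega> t x)) ({0..\<tau>} \<times> sphere 0 1) (exp ((a + b) * S \<omega>))"
    proof eventually_elim
      fix \<omega>
      assume sm: "summable (dyadic_osc \<tau> (\<lambda>t. B t \<omega>))" and B0: "B 0 \<omega> = 0"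
        and Bc: "continuous_on {0..} (\<lambda>t. B t \<omega>)"
      have B: "continuous_on {0..\<tau>} (\<lambda>t. B t \<omega>)"
        by (rule continuous_on_subset[OF Bc]) auto
      have Bb: "\<bar>B t \<omega>\<bar> \<le> S \<omega>" if "t \<in> {0..\<tau>}" for t
        unfolding S_def by (rule abs_le_suminf_dyadic_osc[OF B B0 sm that \<tau>])
      define R where "R = (\<lambda>t. regularize \<epsilon> B t \<omega>)"
      define R' where "R' = (\<lambda>t. scaled_mollifier \<epsilon> 0 * B t \<omega> + integral {0..t} (\<lambda>u. k' (t - u) * B u \<omega>))"
      have R_cont: "continuous_on {0..\<tau>} R" and R'_cont: "continuous_on {0..\<tau>} R'"
        unfolding R_def R'_def regularize_eq_integral[of B \<omega>, OF Bc]
        by (intro continuous_intros continuous_on_Volterra kc B)+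
      have R_le: "R t \<le> a * S \<omega>" if "t \<in> {0..\<tau>}" for t
        using abs_Volterra_le[OF kc(1) K B Bb that]
        unfolding R_def regularize_eq_integral[of B \<omega>, OF Bc] a_def by auto
      have R'_le: "\<bar>R' t\<bar> \<le> b * S \<omega>" if "t \<in> {0..\<tau>}" for t
      proof -
        have "\<bar>scaled_mollifier \<epsilon> 0 * B t \<omega>\<bar> \<le> K * S \<omega>"
          unfolding abs_mult using K[of 0] Bb[OF that] KL \<tau> by (intro mult_mono) auto
        moreover have "\<bar>integral {0..t} (\<lambda>u. k' (t - u) * B u \<omega>)\<bar> \<le> L * \<tau> * S \<omega>"
          using abs_Volterra_le[OF kc(2) L B Bb that] by auto
        ultimately show ?thesis
          unfolding R'_def b_def distrib_right by linarith
      qed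
      have deriv: "((\<lambda>s. flow \<epsilon> B \<omega> s x) has_vector_derivative (exp (R t) * R' t) *\<^sub>R x) (at t within {0..\<tau>})"
        if "t \<in> {0..\<tau>}" for t x
        unfolding R_def R'_def by (rule flow_has_vector_derivative[where B=B and \<omega>=\<omega>, OF k Bc that])
      have dt: "norm (flow_dt \<tau> \<epsilon> B \<omega> t x) = exp (R t) * \<bar>R' t\<bar>"
        if "t \<in> {0..\<tau>}" "x \<in> sphere 0 1" for t x
      proof -
        have "flow_dt \<tau> \<epsilon> B \<omega> t x = (exp (R t) * R' t) *\<^sub>R x"
          unfolding flow_dt_def using \<tau> that deriv by (intro vector_derivative_within_closed_interval) auto
        then show ?thesis using that by (simp add: abs_mult)
      qed
      have dt_le: "exp (R t) * \<bar>R' t\<bar> \<le> exp ((a + b) * S \<omega>)" if "t \<in> {0..\<tau>}" for t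
      proof -
        \<comment> \<open>\<open>y \<le> exp y\<close> moves the linear factor into the exponent;
          hence the sum \<open>a + b\<close> in \<open>C3\<close>.\<close>
        have "\<bar>R' t\<bar> \<le> exp (b * S \<omega>)"
          using R'_le[OF that] exp_ge_add_one_self[of "b * S \<omega>"] by linarith
        then have "exp (R t) * \<bar>R' t\<bar> \<le> exp (a * S \<omega>) * exp (b * S \<omega>)"
          using R_le[OF that] by (intro mult_mono) auto
        then show ?thesis by (simp add: distrib_right exp_add)
      qed
      show "max_le (\<lambda>(t, x). norm (flow \<epsilon> B \<omega> t x)) ({0..\<tau>} \<times> sphere 0 1) (exp (a * S \<omega>)) \<and>
         max_le (\<lambda>(t, x). matrix_opnorm (flow_jacobian \<epsilon> B \<omega> t x)) ({0..\<tau>} \<times> sphere 0 1) (exp (a * S \<omega>)) \<and>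
         (\<forall>t\<in>{0..\<tau>}. \<forall>x\<in>sphere 0 1.
            (\<lambda>s. flow \<epsilon> B \<omega> s x) differentiable (at t within {0..\<tau>})) \<and>
         max_le (\<lambda>(t, x). norm (flow_dt \<tau> \<epsilon> B \<omega> t x)) ({0..\<tau>} \<times> sphere 0 1) (exp ((a + b) * S \<omega>))"
      proof (intro conjI ballI)
        show "max_le (\<lambda>(t, x). norm (flow \<epsilon> B \<omega> t x)) ({0..\<tau>} \<times> sphere 0 1) (exp (a * S \<omega>))"
          using \<tau> R_le R_cont
          by (intro max_le_time_sphere[where g="\<lambda>t. exp (R t)"] continuous_intros) (auto simp: norm_flow R_def)
        show "max_le (\<lambda>(t, x). matrix_opnorm (flow_jacobian \<epsilon> B \<omega> t x)) ({0..\<tau>} \<times> sphere 0 1) (exp (a * S \<omega>))"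
          using \<tau> R_le R_cont
          by (intro max_le_time_sphere[where g="\<lambda>t. exp (R t)"] continuous_intros)
            (auto simp: matrix_opnorm_flow_jacobian R_def)
        show "max_le (\<lambda>(t, x). norm (flow_dt \<tau> \<epsilon> B \<omega> t x)) ({0..\<tau>} \<times> sphere 0 1) (exp ((a + b) * S \<omega>))"
          using \<tau> dt dt_le R_cont R'_cont
          by (intro max_le_time_sphere[where g="\<lambda>t. exp (R t) * \<bar>R' t\<bar>"] continuous_intros) auto
        show "(\<lambda>s. flow \<epsilon> B \<omega> s x) differentiable (at t within {0..\<tau>})" if "t \<in> {0..\<tau>}" for t x
          using deriv[OF that] by (rule differentiableI_vector)
      qed
    qed
    show "in_Lp M p (\<lambda>\<omega>. exp (a * S \<omega>))" "in_Lp M p (\<lambda>\<omega>. exp ((a + b) * S \<omega>))" if "1 \<le> p" for p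
      using ab that by (auto intro!: in_Lp_exp[OF S S_int])
  qed measurable
qed

text \<open>An essentially bounded \<open>C\<close> would bound the regularized motion from above at
  one fixed time, which \<open>brownian_Volterra_unbounded\<close> excludes. The abstract
  \<open>f\<close> covers the flow and the Jacobian at once.\<close>

lemma not_in_Linf_dominating_exp_regularize:
  fixes f :: "'a \<Rightarrow> real \<Rightarrow> real^2 \<Rightarrow> real"
  assumes BM: "standard_brownian_motion M B" and \<tau>: "0 < \<tau>" and \<epsilon>: "0 < \<epsilon>"
    and f: "\<And>\<omega> t x. x \<in> sphere 0 1 \<Longrightarrow> f \<omega> t x = exp (regularize \<epsilon> B t \<omega>)"
    and C: "in_Linf M C" and le: "AE \<omega> in M. max_le (\<lambda>(t, x). f \<omega> t x) ({0..\<tau>} \<times> sphere 0 1) (C \<omega>)"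
  shows False
proof -
  \<comment> \<open>\<open>t < \<epsilon>\<close> keeps \<open>t - u\<close> inside the open support
    of the mollifier for all \<open>u\<close> in \<open>{0..t}\<close>, so the kernel is strictly
    positive there; \<open>t \<le> \<tau>\<close> keeps \<open>t\<close> in the range of the
    maximum.\<close>
  define t where "t = min \<tau> (\<epsilon> / 2)"
  have t: "0 < t" "t \<le> \<tau>" "t < \<epsilon>" using \<tau> \<epsilon> by (auto simp: t_def)
  obtain c where c: "esssup M (\<lambda>\<omega>. ereal \<bar>C \<omega>\<bar>) \<le> ereal c"
    using C unfolding in_Linf_def by (cases "esssup M (\<lambda>\<omega>. ereal \<bar>C \<omega>\<bar>)") auto
  have "AE \<omega> in M. ereal \<bar>C \<omega>\<bar> \<le> esssup M (\<lambda>\<omega>. ereal \<bar>C \<omega>\<bar>)"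
    by (rule esssup_AE)
  moreover have "AE \<omega> in M. continuous_on {0..} (\<lambda>t. B t \<omega>)"
    using BM by (simp add: standard_brownian_motion_def)
  ultimately have "AE \<omega> in M. integral {0..t} (\<lambda>u. scaled_mollifier \<epsilon> (t - u) * B u \<omega>) \<le> c"
    using le
  proof eventually_elim
    fix \<omega>
    assume C_le: "ereal \<bar>C \<omega>\<bar> \<le> esssup M (\<lambda>\<omega>. ereal \<bar>C \<omega>\<bar>)"
      and B: "continuous_on {0..} (\<lambda>t. B t \<omega>)"
      and max: "max_le (\<lambda>(t, x). f \<omega> t x) ({0..\<tau>} \<times> sphere 0 1) (C \<omega>)"
    obtain x :: "real^2" where x: "x \<in> sphere 0 1"
      using vector_choose_size[of 1] by auto
    have "(t, x) \<in> {0..\<tau>} \<times> sphere 0 1" using t x by auto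
    moreover obtain a where "\<forall>b\<in>{0..\<tau>} \<times> sphere 0 1. (case b of (t, x) \<Rightarrow> f \<omega> t x) \<le> (case a of (t, x) \<Rightarrow> f \<omega> t x)"
      "(case a of (t, x) \<Rightarrow> f \<omega> t x) \<le> C \<omega>"
      using max unfolding max_le_def by blast
    ultimately have "f \<omega> t x \<le> C \<omega>" by force
    moreover have "ereal \<bar>C \<omega>\<bar> \<le> ereal c" using C_le c by (rule order.trans)
    ultimately have "exp (regularize \<epsilon> B t \<omega>) \<le> c" unfolding f[OF x] by simp
    then have "regularize \<epsilon> B t \<omega> \<le> c"
      using exp_ge_add_one_self[of "regularize \<epsilon> B t \<omega>"] by linarith
    then show "integral {0..t} (\<lambda>u. scaled_mollifier \<epsilon> (t - u) * B u \<omega>) \<le> c"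
      unfolding regularize_eq_integral[of B \<omega>, OF B] .
  qed
  moreover have "continuous_on {0..t} (scaled_mollifier \<epsilon>)"
    using scaled_mollifier_C1[of \<epsilon>] by (meson DERIV_isCont continuous_at_imp_continuous_on)
  moreover have "0 < scaled_mollifier \<epsilon> s" if "s \<in> {0..t}" for s
    using that t by (intro scaled_mollifier_pos) auto
  ultimately show False
    using brownian_Volterra_unbounded[OF BM t(1)] by blast
qed

theorem lemma3p3:
  fixes M :: "'a measure" and B :: "real \<Rightarrow> 'a \<Rightarrow> real" and \<tau> \<epsilon> :: real
  assumes "prob_space M" and "complete_measure M"
    and "standard_brownian_motion M B"
    and "0 < \<tau>" and "0 < \<epsilon>"
  shows "(\<exists>C1 C2 C3 :: 'a \<Rightarrow> real.
      C1 \<in> borel_measurable M \<and> C2 \<in> borel_measurable M \<and> C3 \<in> borel_measurable M \<and>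
      (AE \<omega> in M.
         max_le (\<lambda>(t, x). norm (flow \<epsilon> B \<omega> t x)) ({0..\<tau>} \<times> sphere 0 1) (C1 \<omega>) \<and>
         max_le (\<lambda>(t, x). matrix_opnorm (flow_jacobian \<epsilon> B \<omega> t x)) ({0..\<tau>} \<times> sphere 0 1) (C2 \<omega>) \<and>
         (\<forall>t\<in>{0..\<tau>}. \<forall>x\<in>sphere 0 1.
            (\<lambda>s. flow \<epsilon> B \<omega> s x) differentiable (at t within {0..\<tau>})) \<and>
         max_le (\<lambda>(t, x). norm (flow_dt \<tau> \<epsilon> B \<omega> t x)) ({0..\<tau>} \<times> sphere 0 1) (C3 \<omega>)) \<and>
      (\<forall>p\<ge>1. in_Lp M p C1 \<and> in_Lp M p C2 \<and> in_Lp M p C3)) \<and>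
    \<not> (\<exists>C. in_Linf M C \<and>
        (AE \<omega> in M. max_le (\<lambda>(t, x). norm (flow \<epsilon> B \<omega> t x)) ({0..\<tau>} \<times> sphere 0 1) (C \<omega>))) \<and>
    \<not> (\<exists>C. in_Linf M C \<and>
        (AE \<omega> in M. max_le (\<lambda>(t, x). matrix_opnorm (flow_jacobian \<epsilon> B \<omega> t x))
                       ({0..\<tau>} \<times> sphere 0 1) (C \<omega>)))"
proof (intro conjI)
  note BM = assms(3-5)
  obtain C1 C3 where C: "C1 \<in> borel_measurable M" "C3 \<in> borel_measurable M"
    "AE \<omega> in M.
       max_le (\<lambda>(t, x). norm (flow \<epsilon> B \<omega> t x)) ({0..\<tau>} \<times> sphere 0 1) (C1 \<omega>) \<and>
       max_le (\<lambda>(t, x). matrix_opnorm (flow_jacobian \<epsilon> B \<omega> t x)) ({0..\<tau>} \<times> sphere 0 1) (C1 \<omega>) \<and>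
       (\<forall>t\<in>{0..\<tau>}. \<forall>x\<in>sphere 0 1.
          (\<lambda>s. flow \<epsilon> B \<omega> s x) differentiable (at t within {0..\<tau>})) \<and>
       max_le (\<lambda>(t, x). norm (flow_dt \<tau> \<epsilon> B \<omega> t x)) ({0..\<tau>} \<times> sphere 0 1) (C3 \<omega>)"
    "\<And>p. 1 \<le> p \<Longrightarrow> in_Lp M p C1" "\<And>p. 1 \<le> p \<Longrightarrow> in_Lp M p C3"
    using flow_Lp_bounds[OF BM] by blast
  show "\<exists>C1 C2 C3 :: 'a \<Rightarrow> real.
      C1 \<in> borel_measurable M \<and> C2 \<in> borel_measurable M \<and> C3 \<in> borel_measurable M \<and>
      (AE \<omega> in M.
         max_le (\<lambda>(t, x). norm (flow \<epsilon> B \<omega> t x)) ({0..\<tau>} \<times> sphere 0 1) (C1 \<omega>) \<and>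
         max_le (\<lambda>(t, x). matrix_opnorm (flow_jacobian \<epsilon> B \<omega> t x)) ({0..\<tau>} \<times> sphere 0 1) (C2 \<omega>) \<and>
         (\<forall>t\<in>{0..\<tau>}. \<forall>x\<in>sphere 0 1.
            (\<lambda>s. flow \<epsilon> B \<omega> s x) differentiable (at t within {0..\<tau>})) \<and>
         max_le (\<lambda>(t, x). norm (flow_dt \<tau> \<epsilon> B \<omega> t x)) ({0..\<tau>} \<times> sphere 0 1) (C3 \<omega>)) \<and>
      (\<forall>p\<ge>1. in_Lp M p C1 \<and> in_Lp M p C2 \<and> in_Lp M p C3)"
    using C by (intro exI[of _ C1] exI[of _ C3]) auto
  show "\<not> (\<exists>C. in_Linf M C \<and>
      (AE \<omega> in M. max_le (\<lambda>(t, x). norm (flow \<epsilon> B \<omega> t x)) ({0..\<tau>} \<times> sphere 0 1) (C \<omega>)))"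
    using not_in_Linf_dominating_exp_regularize[where f="\<lambda>\<omega> t x. norm (flow \<epsilon> B \<omega> t x)", OF BM norm_flow] by blast
  show "\<not> (\<exists>C. in_Linf M C \<and>
      (AE \<omega> in M. max_le (\<lambda>(t, x). matrix_opnorm (flow_jacobian \<epsilon> B \<omega> t x))
                     ({0..\<tau>} \<times> sphere 0 1) (C \<omega>)))"
    using not_in_Linf_dominating_exp_regularize[where f="\<lambda>\<omega> t x. matrix_opnorm (flow_jacobian \<epsilon> B \<omega> t x)",
        OF BM matrix_opnorm_flow_jacobian] by blast
qed

end
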